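(* There is an algorithm on a random access machine which, given $n,m\in\mathbb{N}$ with $n,m\ge1$ and a good instruction sequence $X\in\mathrm{IS}$ with $\mathrm{len}(X)=L(n)+m$ and $\mathrm{iregs}(X)=\{1,\dots,n\}$, decides whether $X$ computes $\mathrm{tstnz}_n$ in time $O(2^{6m}\cdot(n+m)+n\cdot(n+m))$.
   Context: Basic instructions: $\mathtt{in}{:}i.\mathtt{get}$ ($i\ge1$), $\mathtt{out}.\mathtt{set}{:}b$ ($b\in\{0,1\}$), $\mathtt{aux}{:}i.\mathtt{get}$ ($i\ge1$), $\mathtt{aux}{:}i.\mathtt{set}{:}b$ ($i\ge1$, $b\in\{0,1\}$). The part before the dot names a Boolean register ($\mathtt{in}{:}i$ input, $\mathtt{out}$ output, $\mathtt{aux}{:}i$ auxiliary); $\mathtt{get}$ changes nothing and replies the content, $\mathtt{set}{:}b$ makes the content $b$ and replies $b$. Primitive instructions: for each basic instruction $a$, plain $a$, positive test $+a$, negative test $-a$; forward jumps $\#l$ ($l\in\mathbb{N}$); termination $!$. $\mathrm{IS}$ is the set of finite sequences $X=u_1;\dots;u_k$ of primitive instructions, $\mathrm{len}(X)=k$. Execution starts at $u_1$: plain $a$ executes $a$ and proceeds with the next instruction; $+a$ executes $a$ and proceeds with the next instruction if the reply is $1$, otherwise skips the next one and proceeds with the one after it; $-a$ likewise with replies reversed; $\#l$ proceeds with the $l$-th next instruction; $!$ terminates. If $l=0$ or there is no instruction to proceed with, execution never terminates. For $f:\{0,1\}^n\to\{0,1\}$, $X$ computes $f$ if there is $k$ such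 that for all $b_1,\dots,b_n$, executing $X$ with $\mathtt{in}{:}i$ initially $b_i$, $\mathtt{out}$ and $\mathtt{aux}{:}1,\dots,\mathtt{aux}{:}k$ initially $0$ (other registers arbitrary) terminates with final content of $\mathtt{out}$ equal to $f(b_1,\dots,b_n)$. $\mathrm{tstnz}_n(b_1,\dots,b_n)=1$ iff some $b_i=1$. $L(n)=3n/2+1$ for even $n$, $3(n+1)/2$ for odd $n$. Read instructions are $+\mathtt{in}{:}i.\mathtt{get}$ and $-\mathtt{in}{:}i.\mathtt{get}$; $\mathrm{iregs}(X)$ is the set of $i$ such that $\mathtt{in}{:}i$ is read by some read instruction occurring in $X$. A good instruction sequence is one of the form $Y;\mathtt{out}.\mathtt{set}{:}1;!$ where only read instructions and forward jumps $\#l$ with $l>0$ occur in $Y$. Model: random access machine in the sense of Cook and Reckhow (without multiplication/division), uniform cost criterion; each primitive instruction of the input is represented by two integers (its form and its natural-number parameter, or $-1$ if none). *)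

theory Defs
  imports Complex_Main "HOL-Library.Landau_Symbols"
begin

section \<open>Instruction sequences\<close>

datatype basic_instr =
    InGet nat
  | OutSet bool
  | AuxGet nat
  | AuxSet nat bool

datatype prim_instr =
    Plain basic_instr
  | PosTest basic_instr
  | NegTest basic_instr
  | Jump nat
  | Term

fun wf_basic :: "basic_instr \<Rightarrow> bool" where
  "wf_basic (InGet i) \<longleftrightarrow> i \<ge> 1"
| "wf_basic (OutSet b) \<longleftrightarrow> True"
| "wf_basic (AuxGet i) \<longleftrightarrow> i \<ge> 1"
| "wf_basic (AuxSet i b) \<longleftrightarrow> i \<ge> 1"

fun wf_prim :: "prim_instr \<Rightarrow> bool" where
  "wf_prim (Plain a) \<longleftrightarrow> wf_basic a"
| "wf_prim (PosTest a) \<longleftrightarrow> wf_basic a"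
| "wf_prim (NegTest a) \<longleftrightarrow> wf_basic a"
| "wf_prim (Jump l) \<longleftrightarrow> True"
| "wf_prim Term \<longleftrightarrow> True"

definition IS :: "prim_instr list set" where
  "IS = {X. \<forall>u\<in>set X. wf_prim u}"

record reg_state =
  in_reg :: "nat \<Rightarrow> bool"
  out_reg :: bool
  aux_reg :: "nat \<Rightarrow> bool"

fun basic_effect :: "basic_instr \<Rightarrow> reg_state \<Rightarrow> reg_state" where
  "basic_effect (InGet i) s = s"
| "basic_effect (OutSet b) s = s\<lparr>out_reg := b\<rparr>"
| "basic_effect (AuxGet i) s = s"
| "basic_effect (AuxSet i b) s = s\<lparr>aux_reg := (aux_reg s)(i := b)\<rparr>"

fun basic_reply :: "basic_instr \<Rightarrow> reg_state \<Rightarrow> bool" where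
  "basic_reply (InGet i) s = in_reg s i"
| "basic_reply (OutSet b) s = b"
| "basic_reply (AuxGet i) s = aux_reg s i"
| "basic_reply (AuxSet i b) s = b"

text \<open>\<open>exec X p s s'\<close>: execution of \<open>X\<close> from position \<open>p\<close> (counted from 0) in state \<open>s\<close>
  terminates in state \<open>s'\<close>. Non-termination is the absence of such an \<open>s'\<close>.\<close>

inductive exec :: "prim_instr list \<Rightarrow> nat \<Rightarrow> reg_state \<Rightarrow> reg_state \<Rightarrow> bool"
  for X :: "prim_instr list" where
  exec_Term: "\<lbrakk>p < length X; X ! p = Term\<rbrakk> \<Longrightarrow> exec X p s s"
| exec_Plain: "\<lbrakk>p < length X; X ! p = Plain a; exec X (p + 1) (basic_effect a s) s'\<rbrakk>
    \<Longrightarrow> exec X p s s'"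
| exec_PosTest: "\<lbrakk>p < length X; X ! p = PosTest a;
      exec X (if basic_reply a s then p + 1 else p + 2) (basic_effect a s) s'\<rbrakk>
    \<Longrightarrow> exec X p s s'"
| exec_NegTest: "\<lbrakk>p < length X; X ! p = NegTest a;
      exec X (if basic_reply a s then p + 2 else p + 1) (basic_effect a s) s'\<rbrakk>
    \<Longrightarrow> exec X p s s'"
| exec_Jump: "\<lbrakk>p < length X; X ! p = Jump l; l > 0; exec X (p + l) s s'\<rbrakk> \<Longrightarrow> exec X p s s'"

text \<open>An \<open>n\<close>-ary Boolean function is a function on Boolean lists of which only the values on
  lists of length \<open>n\<close> matter; \<open>b\<^sub>i\<close> is \<open>bs ! (i - 1)\<close>.\<close>

definition computes :: "prim_instr list \<Rightarrow> nat \<Rightarrow> (bool list \<Rightarrow> bool) \<Rightarrow> bool" where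
  "computes X n f \<longleftrightarrow>
    (\<exists>k. \<forall>bs s. length bs = n \<longrightarrow>
      (\<forall>i\<in>{1..n}. in_reg s i = bs ! (i - 1)) \<longrightarrow>
      out_reg s = False \<longrightarrow>
      (\<forall>i\<in>{1..k}. aux_reg s i = False) \<longrightarrow>
      (\<exists>s'. exec X 0 s s' \<and> out_reg s' = f bs))"

definition tstnz :: "nat \<Rightarrow> bool list \<Rightarrow> bool" where
  "tstnz n bs \<longleftrightarrow> (\<exists>i\<in>{1..n}. bs ! (i - 1) = True)"

definition L :: "nat \<Rightarrow> nat" where
  "L n = (if even n then 3 * n div 2 + 1 else 3 * (n + 1) div 2)"

definition read_instr :: "nat \<Rightarrow> prim_instr \<Rightarrow> bool" where
  "read_instr i u \<longleftrightarrow> u = PosTest (InGet i) \<or> u = NegTest (InGet i)"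

definition iregs :: "prim_instr list \<Rightarrow> nat set" where
  "iregs X = {i. \<exists>u\<in>set X. read_instr i u}"

definition good :: "prim_instr list \<Rightarrow> bool" where
  "good X \<longleftrightarrow>
    (\<exists>Y. X = Y @ [Plain (OutSet True), Term] \<and>
      (\<forall>u\<in>set Y. (\<exists>i. read_instr i u) \<or> (\<exists>l>0. u = Jump l)))"

section \<open>Random access machines\<close>

text \<open>The machine of Cook and Reckhow, without multiplication and division: registers
  \<open>X\<^sub>0, X\<^sub>1, \<dots>\<close> hold integers and are initially 0. The instructions are, in this order,
  \<open>X\<^sub>i \<leftarrow> c\<close>, \<open>X\<^sub>i \<leftarrow> X\<^sub>j + X\<^sub>k\<close>, \<open>X\<^sub>i \<leftarrow> X\<^sub>j - X\<^sub>k\<close>,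
  \<open>X\<^sub>i \<leftarrow> X\<^bsub>X\<^sub>j\<^esub>\<close>, \<open>X\<^bsub>X\<^sub>i\<^esub> \<leftarrow> X\<^sub>j\<close>, \<open>TRA q if X\<^sub>j > 0\<close>,
  \<open>READ X\<^sub>i\<close>, \<open>PRINT X\<^sub>i\<close>.\<close>

datatype ram_instr =
    RConst nat int
  | RAdd nat nat nat
  | RSub nat nat nat
  | RLoad nat nat
  | RStore nat nat
  | RTra nat nat
  | RRead nat
  | RPrint nat

type_synonym ram_prog = "ram_instr list"

record ram_config =
  ram_pc :: nat
  ram_reg :: "nat \<Rightarrow> int"
  ram_in :: "int list"
  ram_out :: "int list"

fun ram_instr_step :: "ram_instr \<Rightarrow> ram_config \<Rightarrow> ram_config option" where
  "ram_instr_step (RConst i c) \<sigma> =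
     Some (\<sigma>\<lparr>ram_pc := ram_pc \<sigma> + 1, ram_reg := (ram_reg \<sigma>)(i := c)\<rparr>)"
| "ram_instr_step (RAdd i j k) \<sigma> =
     Some (\<sigma>\<lparr>ram_pc := ram_pc \<sigma> + 1,
              ram_reg := (ram_reg \<sigma>)(i := ram_reg \<sigma> j + ram_reg \<sigma> k)\<rparr>)"
| "ram_instr_step (RSub i j k) \<sigma> =
     Some (\<sigma>\<lparr>ram_pc := ram_pc \<sigma> + 1,
              ram_reg := (ram_reg \<sigma>)(i := ram_reg \<sigma> j - ram_reg \<sigma> k)\<rparr>)"
| "ram_instr_step (RLoad i j) \<sigma> =
     (if ram_reg \<sigma> j < 0 then None
      else Some (\<sigma>\<lparr>ram_pc := ram_pc \<sigma> + 1,
                    ram_reg := (ram_reg \<sigma>)(i := ram_reg \<sigma> (nat (ram_reg \<sigma> j)))\<rparr>))"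
| "ram_instr_step (RStore i j) \<sigma> =
     (if ram_reg \<sigma> i < 0 then None
      else Some (\<sigma>\<lparr>ram_pc := ram_pc \<sigma> + 1,
                    ram_reg := (ram_reg \<sigma>)(nat (ram_reg \<sigma> i) := ram_reg \<sigma> j)\<rparr>))"
| "ram_instr_step (RTra q j) \<sigma> =
     Some (\<sigma>\<lparr>ram_pc := (if ram_reg \<sigma> j > 0 then q else ram_pc \<sigma> + 1)\<rparr>)"
| "ram_instr_step (RRead i) \<sigma> =
     (case ram_in \<sigma> of
        [] \<Rightarrow> None
      | z # zs \<Rightarrow> Some (\<sigma>\<lparr>ram_pc := ram_pc \<sigma> + 1,
                         ram_reg := (ram_reg \<sigma>)(i := z), ram_in := zs\<rparr>))"
| "ram_instr_step (RPrint i) \<sigma> =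
     Some (\<sigma>\<lparr>ram_pc := ram_pc \<sigma> + 1, ram_out := ram_out \<sigma> @ [ram_reg \<sigma> i]\<rparr>)"

definition ram_step :: "ram_prog \<Rightarrow> ram_config \<Rightarrow> ram_config \<Rightarrow> bool" where
  "ram_step P \<sigma> \<sigma>' \<longleftrightarrow>
     ram_pc \<sigma> < length P \<and> ram_instr_step (P ! ram_pc \<sigma>) \<sigma> = Some \<sigma>'"

definition ram_init :: "int list \<Rightarrow> ram_config" where
  "ram_init zs = \<lparr>ram_pc = 0, ram_reg = (\<lambda>_. 0), ram_in = zs, ram_out = []\<rparr>"

text \<open>Uniform cost criterion: the time is the number of executed instructions. The machine halts
  when control passes to a nonexistent line. A machine that is stuck (at a negative address or when
  reading beyond the end of the input) does not count as halting.\<close>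

definition ram_halts_with :: "ram_prog \<Rightarrow> int list \<Rightarrow> int list \<Rightarrow> nat \<Rightarrow> bool" where
  "ram_halts_with P zs ws t \<longleftrightarrow>
     (\<exists>\<sigma>. (ram_step P ^^ t) (ram_init zs) \<sigma> \<and> length P \<le> ram_pc \<sigma> \<and> ram_out \<sigma> = ws)"

definition ram_decides_within :: "ram_prog \<Rightarrow> int list \<Rightarrow> bool \<Rightarrow> nat \<Rightarrow> bool" where
  "ram_decides_within P zs Q t \<longleftrightarrow> (\<exists>t'\<le>t. ram_halts_with P zs [if Q then 1 else 0] t')"

section \<open>Representation of the input\<close>

text \<open>The form of a primitive instruction is everything but its natural-number parameter (the
  register index or the jump distance); there are 20 forms, numbered from 0.\<close>

fun basic_form :: "basic_instr \<Rightarrow> int" where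
  "basic_form (InGet i) = 0"
| "basic_form (OutSet b) = (if b then 2 else 1)"
| "basic_form (AuxGet i) = 3"
| "basic_form (AuxSet i b) = (if b then 5 else 4)"

fun basic_param :: "basic_instr \<Rightarrow> int" where
  "basic_param (InGet i) = int i"
| "basic_param (OutSet b) = -1"
| "basic_param (AuxGet i) = int i"
| "basic_param (AuxSet i b) = int i"

fun encode_prim :: "prim_instr \<Rightarrow> int list" where
  "encode_prim (Plain a) = [3 * basic_form a, basic_param a]"
| "encode_prim (PosTest a) = [3 * basic_form a + 1, basic_param a]"
| "encode_prim (NegTest a) = [3 * basic_form a + 2, basic_param a]"
| "encode_prim (Jump l) = [18, int l]"
| "encode_prim Term = [19, -1]"

definition encode_input :: "nat \<Rightarrow> nat \<Rightarrow> prim_instr list \<Rightarrow> int list" where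
  "encode_input n m X = [int n, int m] @ concat (map encode_prim X)"

end

theory Submission
  imports Defs "HOL-Library.Nat_Bijection"
begin

text \<open>Let \<open>X = Y; out.set:1; !\<close>. Comparing the path of \<open>Y\<close> for the zero input with the paths for the unit
  vectors shows that a correct \<open>X\<close> has at most \<open>4m + 2 \<le> 6m\<close> read instructions more than registers; the
  algorithm rejects otherwise. In the remaining case the set \<open>R\<close> of registers read more than once has at
  most \<open>6m\<close> elements. Once the registers in \<open>R\<close> are fixed, every path in \<open>Y\<close> belongs to some input, because
  every other register is read at most once; so whether all inputs with the given values on \<open>R\<close> lead to
  the desired exit is a reachability question, answered by one backward pass over \<open>Y\<close>. The algorithm
  does this for the zero input, for each register set while \<open>R\<close> is otherwise zero (\<open>n\<close> passes), and for
  all nonzero assignments to \<open>R\<close> (at most \<open>2\<^sup>6\<^sup>m\<close> passes).\<close>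

section \<open>Paths through an instruction sequence\<close>

text \<open>The count 4m + 2 comes from \<open>card_reads_le\<close>: with
  \<open>length Y = L n + m - 2\<close> and \<open>2 * L n \<le> 3 * n + 3\<close> it leaves at most
  \<open>n + 4 * m + 2\<close> reads. It is weakened to \<open>n + 6 * m\<close> by
  \<open>m \<ge> 1\<close>. Rejecting by this count has to precede the enumeration, since in an
  incorrect sequence about n/2 + m registers may be read twice, far too many for small m. As every
  register is read at all, each member of R accounts for at least one surplus read, so the same
  number bounds the size of R. The zero input needs a pass with all of \<open>{1..n}\<close>
  cleared, because its exit differs from that of the other inputs that vanish on R. For the same
  reason these others cannot be handled in one pass with R cleared and the rest free: the zero input
  would be among them. Forcing one register to 1 in each of n passes excludes it. A pass costs O(n +
  m), as \<open>length Y\<close> is linear in n and m; the n passes and the at most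
  \<open>2 ^ (6 * m)\<close> passes give the two summands of the time bound.\<close>

fun advance :: "(nat \<Rightarrow> bool) \<Rightarrow> prim_instr \<Rightarrow> nat" where
  "advance x (PosTest (InGet i)) = (if x i then 1 else 2)"
| "advance x (NegTest (InGet i)) = (if x i then 2 else 1)"
| "advance x (Jump l) = max 1 l"
| "advance x _ = 1"

text \<open>Thanks to \<open>max 1 l\<close> even \<open>Jump 0\<close> moves forward, so
  \<open>fin\<close> and \<open>trace\<close> are total for every list. For the jumps of a good
  sequence \<open>max 1 l\<close> is \<open>l\<close>.\<close>

lemma advance_pos: "0 < advance x u"
  by (induction x u rule: advance.induct) auto

definition nxt :: "prim_instr list \<Rightarrow> (nat \<Rightarrow> bool) \<Rightarrow> nat \<Rightarrow> nat" where
  "nxt Y x p = p + advance x (Y ! p)"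

lemma nxt_gt: "p < nxt Y x p"
  using advance_pos by (simp add: nxt_def)

text \<open>The position reached beyond \<open>Y\<close> is kept as the result, since the two
  instructions behind \<open>Y\<close> must be told apart from each other and from positions still
  further out.\<close>

function fin :: "prim_instr list \<Rightarrow> (nat \<Rightarrow> bool) \<Rightarrow> nat \<Rightarrow> nat" where
  "fin Y x p = (if p < length Y then fin Y x (nxt Y x p) else p)"
  by auto
termination
  by (relation "measure (\<lambda>(Y, x, p). length Y - p)") (use nxt_gt in \<open>auto intro: diff_less_mono2\<close>)

declare fin.simps [simp del]

lemma fin_step: "p < length Y \<Longrightarrow> fin Y x p = fin Y x (nxt Y x p)"
  by (subst fin.simps) simp

lemma fin_end: "length Y \<le> p \<Longrightarrow> fin Y x p = p"
  by (subst fin.simps) simp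

lemma fin_ge: "p \<le> fin Y x p"
proof (induction Y x p rule: fin.induct)
  case (1 Y x p)
  then show ?case
    using nxt_gt[of p Y x] by (cases "p < length Y") (auto simp: fin_step fin_end)
qed

text \<open>Runs only move forward, so the distance to the end decreases. The hypothesis covers all
  later positions because the next one depends on the input.\<close>

lemma fin_induct [case_names final step]:
  assumes "\<And>p. length Y \<le> p \<Longrightarrow> P p"
    and "\<And>p. \<lbrakk>p < length Y; \<And>q. p < q \<Longrightarrow> P q\<rbrakk> \<Longrightarrow> P p"
  shows "P p"
proof (induction "length Y - p" arbitrary: p rule: less_induct)
  case less
  show ?case
  proof (cases "p < length Y")
    case True
    then show ?thesis
      by (rule assms(2)) (use True in \<open>auto intro!: less\<close>)
  qed (simp add: assms(1))
qed

definition reads :: "prim_instr list \<Rightarrow> nat set" where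
  "reads Y = {p. p < length Y \<and> (\<exists>i. read_instr i (Y ! p))}"

definition reads_of :: "prim_instr list \<Rightarrow> nat \<Rightarrow> nat set" where
  "reads_of Y i = {p. p < length Y \<and> read_instr i (Y ! p)}"

lemma finite_reads [simp]: "finite (reads Y)" "finite (reads_of Y i)"
  by (auto simp: reads_def reads_of_def)

lemma advance_cong: "(\<And>i. read_instr i u \<Longrightarrow> x i = y i) \<Longrightarrow> advance x u = advance y u"
  by (induction x u rule: advance.induct) (auto simp: read_instr_def)

lemma nxt_cong:
  "\<lbrakk>p < length Y; \<And>i. p \<in> reads_of Y i \<Longrightarrow> x i = y i\<rbrakk> \<Longrightarrow> nxt Y x p = nxt Y y p"
  unfolding nxt_def reads_of_def using advance_cong[of "Y ! p" x y] by simp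

lemma fin_cong:
  "(\<And>q i. \<lbrakk>p \<le> q; q \<in> reads_of Y i\<rbrakk> \<Longrightarrow> x i = y i) \<Longrightarrow> fin Y x p = fin Y y p"
proof (induction p rule: fin_induct[of Y])
  case (step p)
  have "nxt Y x p = nxt Y y p"
    using step by (intro nxt_cong) auto
  moreover have "fin Y x (nxt Y x p) = fin Y y (nxt Y x p)"
    using step.IH[OF nxt_gt] step.prems nxt_gt[of p Y x] by (metis less_imp_le_nat order.trans)
  ultimately show ?case
    using step by (simp add: fin_step[of p])
qed (simp add: fin_end)

function trace :: "prim_instr list \<Rightarrow> (nat \<Rightarrow> bool) \<Rightarrow> nat \<Rightarrow> nat set" where
  "trace Y x p = (if p < length Y then insert p (trace Y x (nxt Y x p)) else {})"
  by auto
termination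
  by (relation "measure (\<lambda>(Y, x, p). length Y - p)") (use nxt_gt in \<open>auto intro: diff_less_mono2\<close>)

declare trace.simps [simp del]

lemma trace_step: "p < length Y \<Longrightarrow> trace Y x p = insert p (trace Y x (nxt Y x p))"
  by (subst trace.simps) simp

lemma trace_end: "length Y \<le> p \<Longrightarrow> trace Y x p = {}"
  by (subst trace.simps) simp

lemma trace_bounds: "q \<in> trace Y x p \<Longrightarrow> p \<le> q \<and> q < length Y"
proof (induction p rule: fin_induct[of Y])
  case (step p)
  then show ?case
    using nxt_gt[of p Y x] by (fastforce simp: trace_step[of p])
qed (simp add: trace_end)

lemma trace_nxt:
  "q \<in> trace Y x p \<Longrightarrow> nxt Y x q < length Y \<Longrightarrow> nxt Y x q \<in> trace Y x p"
proof (induction p rule: fin_induct[of Y])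
  case (step p)
  show ?case
  proof (cases "q = p")
    case True
    then show ?thesis
      using step.prems by (simp add: trace_step[OF step.hyps] trace_step[of "nxt Y x p"])
  next
    case False
    then have "q \<in> trace Y x (nxt Y x p)"
      using step.prems by (simp add: trace_step[OF step.hyps])
    then show ?thesis
      using step.IH[OF nxt_gt] step.prems by (simp add: trace_step[OF step.hyps])
  qed
qed (simp add: trace_end)

lemma fin_trace: "q \<in> trace Y x p \<Longrightarrow> fin Y x p = fin Y x q"
proof (induction p rule: fin_induct[of Y])
  case (step p)
  from step.prems have "q = p \<or> q \<in> trace Y x (nxt Y x p)"
    by (simp add: trace_step[OF step.hyps])
  then show ?case
    using step.IH[OF nxt_gt[of p Y x]] fin_step[OF step.hyps, of x] by auto
qed (simp add: trace_end)

text \<open>As long as the inputs agree on the reads met so far, both runs share one path; agreement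
  along the path of \<open>x\<close> therefore suffices, whereas \<open>fin_cong\<close> asks for it
  at every read behind \<open>p\<close>.\<close>

lemma fin_cong_trace:
  assumes "\<And>q i. \<lbrakk>q \<in> trace Y x p; q \<in> reads_of Y i\<rbrakk> \<Longrightarrow> x i = y i"
  shows "fin Y x p = fin Y y p"
  using assms
proof (induction p rule: fin_induct[of Y])
  case (step p)
  have "nxt Y x p = nxt Y y p"
    using step.hyps step.prems by (intro nxt_cong) (auto simp: trace_step[OF step.hyps])
  moreover have "fin Y x (nxt Y x p) = fin Y y (nxt Y x p)"
    by (rule step.IH[OF nxt_gt]) (use step.prems in \<open>auto simp: trace_step[OF step.hyps]\<close>)
  ultimately show ?case
    by (simp add: fin_step[OF step.hyps])
qed (simp add: fin_end)

text \<open>From \<open>q\<close> on the two inputs may part, so the conclusion speaks of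
  \<open>y\<close> alone: its run follows the path of \<open>x\<close> up to
  \<open>q\<close>.\<close>

lemma fin_cong_trace_until:
  assumes "q \<in> trace Y x p"
    and "\<And>r i. \<lbrakk>r \<in> trace Y x p; r < q; r \<in> reads_of Y i\<rbrakk> \<Longrightarrow> x i = y i"
  shows "fin Y y p = fin Y y q"
  using assms
proof (induction p rule: fin_induct[of Y])
  case (step p)
  show ?case
  proof (cases "q = p")
    case False
    then have q: "q \<in> trace Y x (nxt Y x p)"
      using step.prems by (simp add: trace_step[OF step.hyps])
    then have "p < q"
      using trace_bounds nxt_gt by (meson less_le_trans)
    then have "nxt Y x p = nxt Y y p"
      using step.hyps step.prems by (intro nxt_cong) (auto simp: trace_step[OF step.hyps])
    moreover have "fin Y y (nxt Y x p) = fin Y y q"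
      by (rule step.IH[OF nxt_gt q]) (use step.prems in \<open>auto simp: trace_step[OF step.hyps]\<close>)
    ultimately show ?thesis
      by (simp add: fin_step[OF step.hyps])
  qed simp
qed (simp add: trace_end)

lemma trace_suffix: "q \<in> trace Y x p \<Longrightarrow> trace Y x q \<subseteq> trace Y x p"
proof (induction p rule: fin_induct[of Y])
  case (step p)
  from step.prems have "q = p \<or> q \<in> trace Y x (nxt Y x p)"
    by (simp add: trace_step[OF step.hyps])
  then show ?case
    using step.IH[OF nxt_gt[of p Y x]] trace_step[OF step.hyps, of x] by auto
qed (simp add: trace_end)

text \<open>\<open>nonzero_test Y n\<close> says that the run of \<open>Y\<close> leaves at \<open>out.set:1\<close> (position \<open>length Y\<close>) for
  nonzero inputs and at \<open>!\<close> (position \<open>length Y + 1\<close>) for the zero input.\<close>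

definition nonzero_test :: "prim_instr list \<Rightarrow> nat \<Rightarrow> bool" where
  "nonzero_test Y n \<longleftrightarrow>
     (\<forall>x. fin Y x 0 = (if \<exists>i\<in>{1..n}. x i then length Y else length Y + 1))"

section \<open>Executions of a good sequence and exits of its paths\<close>

definition reads_and_jumps :: "prim_instr list \<Rightarrow> bool" where
  "reads_and_jumps Y \<longleftrightarrow> (\<forall>u\<in>set Y. (\<exists>i. read_instr i u) \<or> (\<exists>l>0. u = Jump l))"

lemma reads_and_jumps_cases:
  assumes "reads_and_jumps Y" and "p < length Y"
  obtains i where "Y ! p = PosTest (InGet i)" | i where "Y ! p = NegTest (InGet i)"
    | l where "Y ! p = Jump l" "l > 0"
  using assms nth_mem[of p Y] unfolding reads_and_jumps_def read_instr_def by blast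

lemma exec_imp_fin:
  assumes Y: "reads_and_jumps Y" and "exec (Y @ [Plain (OutSet True), Term]) p s s'"
  shows "fin Y (in_reg s) p = length Y \<and> out_reg s' \<or>
         fin Y (in_reg s) p = length Y + 1 \<and> out_reg s' = out_reg s"
  using assms(2)
proof (induction rule: exec.induct)
  case (exec_Term p s)
  have "\<not> p < length Y"
  proof
    assume p: "p < length Y"
    from Y p show False
      by (cases rule: reads_and_jumps_cases) (use exec_Term.hyps p in \<open>auto simp: nth_append\<close>)
  qed
  then show ?case
    using exec_Term by (auto simp: nth_append nth_Cons' fin_end split: if_splits)
next
  case (exec_Plain p a s s')
  have "\<not> p < length Y"
  proof
    assume p: "p < length Y"
    from Y p show False
      by (cases rule: reads_and_jumps_cases) (use exec_Plain.hyps p in \<open>auto simp: nth_append\<close>)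
  qed
  then have "p = length Y" "a = OutSet True"
    using exec_Plain by (auto simp: nth_append nth_Cons' split: if_splits)
  then show ?case
    using exec_Plain by (auto simp: fin_end)
next
  case (exec_PosTest p a s s')
  then have p: "p < length Y" and u: "Y ! p = PosTest a"
    by (auto simp: nth_append nth_Cons' split: if_splits)
  from Y p obtain i where "a = InGet i"
    by (cases rule: reads_and_jumps_cases) (use u in auto)
  then show ?case
    using exec_PosTest p u by (auto simp: fin_step[of p] nxt_def split: if_splits)
next
  case (exec_NegTest p a s s')
  then have p: "p < length Y" and u: "Y ! p = NegTest a"
    by (auto simp: nth_append nth_Cons' split: if_splits)
  from Y p obtain i where "a = InGet i"
    by (cases rule: reads_and_jumps_cases) (use u in auto)
  then show ?case
    using exec_NegTest p u by (auto simp: fin_step[of p] nxt_def split: if_splits)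
next
  case (exec_Jump p l s s')
  then have p: "p < length Y" and u: "Y ! p = Jump l"
    by (auto simp: nth_append nth_Cons' split: if_splits)
  have "max 1 l = l"
    using exec_Jump by simp
  then show ?case
    using exec_Jump.IH p u by (simp add: fin_step[of p] nxt_def)
qed

lemma fin_imp_exec:
  assumes Y: "reads_and_jumps Y" and "fin Y (in_reg s) p \<in> {length Y, length Y + 1}"
  shows "\<exists>s'. exec (Y @ [Plain (OutSet True), Term]) p s s'"
  using assms(2)
proof (induction p rule: fin_induct[of Y])
  case (final p)
  let ?X = "Y @ [Plain (OutSet True), Term]"
  have T: "exec ?X (length Y + 1) s' s'" for s'
    by (rule exec_Term) (auto simp: nth_append)
  have "exec ?X (length Y) s (s\<lparr>out_reg := True\<rparr>)"
    by (rule exec_Plain[where a = "OutSet True"]) (use T in \<open>auto simp: nth_append\<close>)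
  then show ?case
    using final T by (auto simp: fin_end)
next
  case (step p)
  let ?X = "Y @ [Plain (OutSet True), Term]"
  obtain s' where s': "exec ?X (nxt Y (in_reg s) p) s s'"
    using step.IH[OF nxt_gt] step.prems step.hyps by (auto simp: fin_step[of p])
  have p: "p < length ?X" "?X ! p = Y ! p"
    using step.hyps by (auto simp: nth_append)
  from Y step.hyps have "exec ?X p s s'"
  proof (cases rule: reads_and_jumps_cases)
    case (1 i)
    show ?thesis
      by (rule exec_PosTest[where a = "InGet i"]) (use 1 p s' in \<open>auto simp: nxt_def split: if_splits\<close>)
  next
    case (2 i)
    show ?thesis
      by (rule exec_NegTest[where a = "InGet i"]) (use 2 p s' in \<open>auto simp: nxt_def split: if_splits\<close>)
  next
    case (3 l)
    then have "nxt Y (in_reg s) p = p + l"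
      by (simp add: nxt_def)
    show ?thesis
      by (rule exec_Jump[where l = l]) (use 3 p s' \<open>nxt Y (in_reg s) p = p + l\<close> in auto)
  qed
  then show ?case ..
qed

text \<open>\<open>Y\<close> writes no register, so \<open>out\<close> keeps its initial 0 until the
  run leaves \<open>Y\<close>: leaving at \<open>length Y\<close> sets it to 1, leaving at
  \<open>length Y + 1\<close> terminates at once, and leaving further out never terminates.\<close>

lemma computes_tstnz_iff:
  assumes Y: "reads_and_jumps Y"
  shows "computes (Y @ [Plain (OutSet True), Term]) n (tstnz n) \<longleftrightarrow> nonzero_test Y n"
    (is "computes ?X _ _ \<longleftrightarrow> _")
proof
  assume "computes ?X n (tstnz n)"
  then obtain k where k: "\<And>bs s. \<lbrakk>length bs = n; \<forall>i\<in>{1..n}. in_reg s i = bs ! (i - 1);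
      out_reg s = False; \<forall>i\<in>{1..k}. aux_reg s i = False\<rbrakk>
      \<Longrightarrow> \<exists>s'. exec ?X 0 s s' \<and> out_reg s' = tstnz n bs"
    unfolding computes_def by blast
  show "nonzero_test Y n"
    unfolding nonzero_test_def
  proof
    fix x
    \<comment> \<open>With every auxiliary register 0 the initial condition is met whatever
      \<open>k\<close> is.\<close>
    define s where "s = \<lparr>in_reg = x, out_reg = False, aux_reg = \<lambda>_. False\<rparr>"
    define bs where "bs = map x [1..<Suc n]"
    have bs: "length bs = n" "\<forall>i\<in>{1..n}. x i = bs ! (i - 1)"
      by (auto simp: bs_def nth_append simp del: upt_Suc)
    obtain s' where "exec ?X 0 s s'" "out_reg s' = tstnz n bs"
      using k[of bs s] bs by (auto simp: s_def)
    moreover have "tstnz n bs \<longleftrightarrow> (\<exists>i\<in>{1..n}. x i)"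
      using bs by (auto simp: tstnz_def)
    ultimately show "fin Y x 0 = (if \<exists>i\<in>{1..n}. x i then length Y else length Y + 1)"
      using exec_imp_fin[OF Y, of 0 s s'] by (auto simp: s_def)
  qed
next
  assume nz: "nonzero_test Y n"
  show "computes ?X n (tstnz n)"
    unfolding computes_def
  proof (intro exI[of _ 0] allI impI)
    fix bs and s :: reg_state
    assume *: "length bs = n" "\<forall>i\<in>{1..n}. in_reg s i = bs ! (i - 1)" "out_reg s = False"
    have f: "fin Y (in_reg s) 0 = (if tstnz n bs then length Y else length Y + 1)"
      using nz * by (auto simp: nonzero_test_def tstnz_def)
    then obtain s' where "exec ?X 0 s s'"
      using fin_imp_exec[OF Y, of s 0] by (auto split: if_splits)
    then show "\<exists>s'. exec ?X 0 s s' \<and> out_reg s' = tstnz n bs"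
      using exec_imp_fin[OF Y, of 0 s s'] f *(3) by (auto split: if_splits)
  qed
qed

section \<open>Counting the read instructions of a correct sequence\<close>

lemma reads_of_unique: "\<lbrakk>p \<in> reads_of Y i; p \<in> reads_of Y j\<rbrakk> \<Longrightarrow> i = j"
  by (auto simp: reads_of_def read_instr_def)

lemma trace_finite: "finite (trace Y x p)"
  by (rule finite_subset[of _ "{..<length Y}"]) (auto dest: trace_bounds)

text \<open>Every register is read on the path taken for the zero input. If register \<open>i\<close> is read only once
  there, then the run for the \<open>i\<close>-th unit vector leaves that path for good at that read, so its next
  position lies off the path; at most two registers share such a position. If the position holds a
  read instruction again, one of the two positions behind it is off the path as well, and at most
  one register uses that one.\<close>

theorem card_reads_le:
  assumes nz: "nonzero_test Y n"
  shows "card (reads Y) + 5 * n \<le> 4 * length Y + 4"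
proof -
  define K where "K = length Y"
  define z where "z = (\<lambda>_::nat. False)"
  define e where "e i = (\<lambda>j. j = i)" for i :: nat
  define On where "On = trace Y z 0"
  \<comment> \<open>\<open>K\<close> is included because a deviation may lead straight to the exit
    \<open>out.set:1\<close>; the zero path itself leaves at \<open>K + 1\<close>.\<close>
  define Off where "Off = {..K} - On"
  define R where "R i = On \<inter> reads_of Y i" for i
  define S where "S = {i \<in> {1..n}. card (R i) = 1}"
  have On_lt: "q < K" if "q \<in> On" for q
    using trace_bounds that by (auto simp: On_def K_def)
  have [simp]: "finite On" "finite Off" "finite (R i)" "finite S" for i
    by (auto simp: On_def Off_def R_def S_def trace_finite)
  have z0: "fin Y z 0 = K + 1"
    using nz by (simp add: nonzero_test_def z_def K_def)
  have e0: "fin Y (e i) 0 = K" if "i \<in> {1..n}" for i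
    using nz that by (auto simp: nonzero_test_def e_def K_def)
  \<comment> \<open>Otherwise the unit vector would follow the zero path to the wrong exit.\<close>
  have R_nonempty: "R i \<noteq> {}" if i: "i \<in> {1..n}" for i
  proof
    assume "R i = {}"
    then have "fin Y z 0 = fin Y (e i) 0"
      by (intro fin_cong_trace) (auto simp: R_def On_def z_def e_def)
    then show False
      using z0 e0[OF i] by simp
  qed
  define pos where "pos i = the_elem (R i)" for i
  have R_pos: "R i = {pos i}" if "i \<in> S" for i
  proof -
    have "card (R i) = 1"
      using that by (simp add: S_def)
    then obtain a where "R i = {a}"
      by (rule card_1_singletonE)
    then show ?thesis
      by (simp add: pos_def)
  qed
  have R_mem: "r = pos i" if "i \<in> S" "r \<in> On" "r \<in> reads_of Y i" for i r
    using R_pos[of i] that by (auto simp: R_def)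
  define dev where "dev i = nxt Y (e i) (pos i)" for i
  have pos_On: "pos i \<in> On" "pos i \<in> reads_of Y i" if "i \<in> S" for i
    using R_pos[OF that] by (auto simp: R_def)
  have pos_inj: "inj_on pos S"
    by (rule inj_onI) (metis pos_On(2) reads_of_unique)
  have fin_dev: "fin Y (e i) (dev i) = K" if i: "i \<in> S" for i
  proof -
    have "fin Y (e i) 0 = fin Y (e i) (pos i)"
    proof (rule fin_cong_trace_until[of _ _ z])
      show "pos i \<in> trace Y z 0"
        using pos_On[OF i] by (simp add: On_def)
      fix r j assume "r \<in> trace Y z 0" "r < pos i" "r \<in> reads_of Y j"
      then have "j \<noteq> i"
        using R_mem[OF i, of r] by (auto simp: On_def)
      then show "z j = e i j"
        by (simp add: z_def e_def)
    qed
    then show ?thesis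
      using fin_step[of "pos i" Y "e i"] On_lt[OF pos_On(1)[OF i]] e0[of i] i
      by (simp add: dev_def K_def S_def)
  qed
  \<comment> \<open>Behind \<open>pos i\<close> the zero path does not read register
    \<open>i\<close> any more. So from a position on that path the unit vector would end at
    \<open>K + 1\<close> as the zero input does.\<close>
  have off: "q \<in> Off" if i: "i \<in> S" and q: "pos i < q" "fin Y (e i) q = K" for i q
  proof -
    have "q \<notin> On"
    proof
      assume "q \<in> On"
      then have t: "q \<in> trace Y z 0"
        by (simp add: On_def)
      have "fin Y z q = fin Y (e i) q"
      proof (rule fin_cong_trace)
        fix r j assume r: "r \<in> trace Y z q" "r \<in> reads_of Y j"
        have "r \<in> On" "r \<noteq> pos i"
          using trace_suffix[OF t] trace_bounds[OF r(1)] r q by (auto simp: On_def)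
        then have "j \<noteq> i"
          using R_mem[OF i, of r] r by auto
        then show "z j = e i j"
          by (simp add: z_def e_def)
      qed
      then show False
        using fin_trace[OF t] z0 q by simp
    qed
    then show ?thesis
      using fin_ge[of q Y "e i"] q by (simp add: Off_def)
  qed
  have dev_Off: "dev i \<in> Off" if "i \<in> S" for i
    using off[OF that] fin_dev[OF that] nxt_gt by (simp add: dev_def)
  \<comment> \<open>A read continues at one of the two following positions. If the unit vector takes
    the second, the zero path takes the first.\<close>
  have dev_cases: "dev i = pos i + 1 \<or> dev i = pos i + 2 \<and> (pos i + 1 < K \<longrightarrow> pos i + 1 \<in> On)"
    if i: "i \<in> S" for i
  proof -
    have "nxt Y z (pos i) < K \<longrightarrow> nxt Y z (pos i) \<in> On"
      using trace_nxt pos_On[OF i] by (auto simp: On_def K_def)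
    then show ?thesis
      using pos_On(2)[OF i]
      by (auto simp: reads_of_def read_instr_def nxt_def dev_def e_def z_def)
  qed
  define served where "served q = {i \<in> S. dev i = q}" for q
  have served_le: "card (served q) \<le> card P" if "pos ` served q \<subseteq> P" "finite P" for q P
  proof (rule card_inj_on_le[OF _ that])
    show "inj_on pos (served q)"
      using pos_inj by (rule inj_on_subset) (auto simp: served_def)
  qed
  have served_2: "card (served q) \<le> 2" for q
  proof -
    have "card (served q) \<le> card {q - 1, q - 2}"
      by (rule served_le) (use dev_cases in \<open>fastforce simp: served_def\<close>)+
    also have "\<dots> \<le> 2"
      by (simp add: card_insert_if)
    finally show ?thesis .
  qed
  \<comment> \<open>Only reads at \<open>q\<close> or \<open>q - 1\<close> could deviate to
    \<open>q + 1\<close>. The former position is off the zero path, and for the latter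
    \<open>dev_cases\<close> would put \<open>q\<close> on that path.\<close>
  have served_Suc: "card (served (q + 1)) \<le> 1" if "q \<in> Off" "q < K" for q
  proof -
    have "served (q + 1) = {}"
      using dev_cases pos_On that by (fastforce simp: served_def Off_def)
    then show ?thesis
      by simp
  qed
  \<comment> \<open>Of the two possible sources \<open>q\<close> and \<open>q + 1\<close>, the first
    is off the zero path.\<close>
  have served_Suc_Suc: "card (served (q + 2)) \<le> 1" if "q \<in> Off" for q
  proof -
    have "card (served (q + 2)) \<le> card {q + 1}"
      by (rule served_le) (use dev_cases pos_On that in \<open>fastforce simp: served_def Off_def\<close>)+
    then show ?thesis
      by simp
  qed
  define Z0 where "Z0 = {q \<in> Off. card (served q) = 0}"
  define Z1 where "Z1 = {q \<in> Off. card (served q) = 1}"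
  have [simp]: "finite (served q)" "finite Z0" "finite Z1" for q
    by (auto simp: served_def Z0_def Z1_def)
  \<comment> \<open>Every position off the path has room for two registers; \<open>Z1\<close> and
    \<open>Z0\<close> count the room left over, one place and two places each.\<close>
  have S_le: "card S + card Z1 + 2 * card Z0 \<le> 2 * card Off"
  proof -
    have "card S = (\<Sum>q\<in>Off. card (served q))"
      using sum.group[of S Off dev "\<lambda>_. 1::nat"] dev_Off by (simp add: served_def image_subset_iff)
    moreover have "card Z1 = (\<Sum>q\<in>Off. if card (served q) = 1 then 1 else 0)"
      "card Z0 = (\<Sum>q\<in>Off. if card (served q) = 0 then 1 else 0)"
      unfolding Z0_def Z1_def card_eq_sum by (rule sum.inter_filter; simp)+
    ultimately have "card S + card Z1 + 2 * card Z0 = (\<Sum>q\<in>Off. card (served q) +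
        (if card (served q) = 1 then 1 else 0) + 2 * (if card (served q) = 0 then 1 else 0))"
      by (simp only: sum.distrib sum_distrib_left)
    also have "\<dots> \<le> (\<Sum>q\<in>Off. 2)"
    proof (rule sum_mono)
      fix q
      show "card (served q) + (if card (served q) = 1 then 1 else 0) +
          2 * (if card (served q) = 0 then 1 else 0) \<le> 2"
        using served_2[of q] by auto
    qed
    finally show ?thesis
      by simp
  qed
  \<comment> \<open>An unserved read lies in \<open>Z0\<close> itself. A served one is followed by
    some \<open>u\<close> in \<open>Z0 \<union> Z1\<close>, and each \<open>u\<close> is charged by
    at most the two reads at \<open>u - 1\<close> and \<open>u - 2\<close>. Hence the weights 1 + 2
    for \<open>Z0\<close> and 2 for \<open>Z1\<close>.\<close>
  have off_reads: "card (reads Y - On) \<le> 3 * card Z0 + 2 * card Z1"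
  proof -
    let ?D = "Z0 \<union> Z1"
    have "reads Y - On \<subseteq> Z0 \<union> ((\<lambda>u. u - 1) ` ?D \<union> (\<lambda>u. u - 2) ` ?D)"
    proof
      fix q assume q: "q \<in> reads Y - On"
      then have qK: "q < K" and qOff: "q \<in> Off"
        by (auto simp: reads_def Off_def K_def)
      show "q \<in> Z0 \<union> ((\<lambda>u. u - 1) ` ?D \<union> (\<lambda>u. u - 2) ` ?D)"
      proof (cases "served q = {}")
        case True
        then show ?thesis
          using qOff by (simp add: Z0_def)
      next
        case False
        then obtain i where i: "i \<in> S" "dev i = q"
          by (auto simp: served_def)
        define u where "u = nxt Y (e i) q"
        have u: "u = q + 1 \<or> u = q + 2"
          using q by (auto simp: u_def nxt_def reads_def read_instr_def split: if_splits)
        have "fin Y (e i) u = K"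
          using fin_dev[OF i(1)] fin_step[of q Y "e i"] qK i by (simp add: u_def K_def)
        moreover have "pos i < u"
          using nxt_gt[of "pos i" Y "e i"] nxt_gt[of q Y "e i"] i(2) by (simp add: dev_def u_def)
        ultimately have "u \<in> Off"
          using off i by blast
        moreover have "card (served u) \<le> 1"
          using u served_Suc[OF qOff qK] served_Suc_Suc[OF qOff] by auto
        then have "card (served u) = 0 \<or> card (served u) = 1"
          by linarith
        ultimately have "u \<in> ?D"
          unfolding Z0_def Z1_def by blast
        moreover have "q = u - 1 \<or> q = u - 2"
          using u by auto
        ultimately show ?thesis
          by blast
      qed
    qed
    then have "card (reads Y - On) \<le> card (Z0 \<union> ((\<lambda>u. u - 1) ` ?D \<union> (\<lambda>u. u - 2) ` ?D))"
      by (rule card_mono[rotated]) simp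
    also have "\<dots> \<le> card Z0 + (card ((\<lambda>u. u - 1) ` ?D) + card ((\<lambda>u. u - 2) ` ?D))"
      by (meson add_left_mono card_Un_le order_trans)
    also have "\<dots> \<le> card Z0 + (card ?D + card ?D)"
      by (intro add_mono card_image_le order_refl) auto
    also have "\<dots> \<le> card Z0 + 2 * (card Z0 + card Z1)"
      using card_Un_le[of Z0 Z1] by simp
    finally show ?thesis
      by simp
  qed
  have on_reads: "2 * n \<le> card (reads Y \<inter> On) + card S" "n \<le> card (reads Y \<inter> On)"
  proof -
    have sub: "(\<Sum>i\<in>{1..n}. card (R i)) \<le> card (reads Y \<inter> On)"
    proof -
      have "(\<Sum>i\<in>{1..n}. card (R i)) = card (\<Union>i\<in>{1..n}. R i)"
        by (rule card_UN_disjoint[symmetric]) (auto simp: R_def dest: reads_of_unique)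
      also have "\<dots> \<le> card (reads Y \<inter> On)"
        by (rule card_mono) (auto simp: R_def reads_of_def reads_def)
      finally show ?thesis .
    qed
    have R1: "1 \<le> card (R i)" if "i \<in> {1..n}" for i
      using R_nonempty[OF that] by (simp add: Suc_le_eq card_gt_0_iff)
    have "(\<Sum>i\<in>{1..n}. 1) \<le> (\<Sum>i\<in>{1..n}. card (R i))"
      using R1 by (rule sum_mono)
    then show "n \<le> card (reads Y \<inter> On)"
      using sub by simp
    have "card S = (\<Sum>i\<in>{1..n}. if card (R i) = 1 then 1 else 0)"
      unfolding S_def card_eq_sum by (rule sum.inter_filter) simp
    then have "(\<Sum>i\<in>{1..n}. card (R i)) + card S =
        (\<Sum>i\<in>{1..n}. card (R i) + (if card (R i) = 1 then 1 else 0))"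
      by (simp only: sum.distrib)
    also have "\<dots> \<ge> (\<Sum>i\<in>{1..n}. 2)"
    proof (rule sum_mono)
      fix i assume "i \<in> {1..n}"
      then show "2 \<le> card (R i) + (if card (R i) = 1 then 1 else 0)"
        using R1[of i] by auto
    qed
    finally show "2 * n \<le> card (reads Y \<inter> On) + card S"
      using sub by simp
  qed
  have "card Off = K + 1 - card On"
    unfolding Off_def using On_lt by (subst card_Diff_subset) (auto intro: less_imp_le)
  moreover have "card On \<le> K"
    using card_mono[of "{..<K}" On] On_lt by auto
  moreover have "card (reads Y \<inter> On) \<le> card On"
    by (rule card_mono) auto
  moreover have "card (reads Y) = card (reads Y \<inter> On) + card (reads Y - On)"
    by (metis card_Int_Diff finite_reads(1) inf_commute)
  \<comment> \<open>Let \<open>a\<close> be the number of reads on the path and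
    \<open>s = card S\<close>. Twice \<open>S_le\<close> bounds the other reads by
    \<open>4 * card Off - 2 * s\<close>. With \<open>card Off = K + 1 - card On\<close> and
    \<open>a \<le> card On\<close> the total is at most \<open>4 * K + 4 - (3 * a + 2 * s)\<close>,
    and \<open>3 * a + 2 * s = a + 2 * (a + s)\<close> is at least \<open>n + 4 * n\<close>.\<close>
  ultimately show ?thesis
    using S_le off_reads on_reads unfolding K_def by linarith
qed

section \<open>Safety of a position under a partial assignment\<close>

text \<open>A partial assignment maps a register to \<open>1\<close> (set), \<open>-1\<close> (cleared) or \<open>0\<close> (free).\<close>

definition consistent :: "(nat \<Rightarrow> int) \<Rightarrow> (nat \<Rightarrow> bool) \<Rightarrow> bool" where
  "consistent V x \<longleftrightarrow> (\<forall>i. (V i > 0 \<longrightarrow> x i) \<and> (V i < 0 \<longrightarrow> \<not> x i))"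

definition safe :: "prim_instr list \<Rightarrow> (nat \<Rightarrow> int) \<Rightarrow> nat \<Rightarrow> nat \<Rightarrow> bool" where
  "safe Y V t p \<longleftrightarrow> (\<forall>x. consistent V x \<longrightarrow> fin Y x p = t)"

definition free_once :: "prim_instr list \<Rightarrow> (nat \<Rightarrow> int) \<Rightarrow> bool" where
  "free_once Y V \<longleftrightarrow> (\<forall>i. V i = 0 \<longrightarrow> card (reads_of Y i) \<le> 1)"

lemma safe_end:
  assumes "length Y \<le> p"
  shows "safe Y V t p \<longleftrightarrow> p = t"
proof -
  \<comment> \<open>Some input is consistent with \<open>V\<close>, so \<open>safe\<close> is never
    vacuously true.\<close>
  have "consistent V (\<lambda>i. V i > 0)"
    by (simp add: consistent_def)
  then show ?thesis
    using assms by (auto simp: safe_def fin_end)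
qed

lemma safe_jump:
  assumes "p < length Y" "Y ! p = Jump l" "l > 0"
  shows "safe Y V t p \<longleftrightarrow> safe Y V t (p + l)"
proof -
  have "fin Y x p = fin Y x (p + l)" for x
    using assms fin_step[of p Y x] by (simp add: nxt_def)
  then show ?thesis
    by (simp add: safe_def)
qed

text \<open>A fixed register leaves one branch open. For a free register, \<open>p\<close> is its
  only read by \<open>free_once\<close>, so behind \<open>p\<close> its value is irrelevant: an
  input that starts in either branch can be altered at \<open>i\<close> so that its run from
  \<open>p\<close> enters that branch, and it ends at the same exit.\<close>

lemma safe_read:
  assumes p: "p \<in> reads_of Y i" and once: "free_once Y V"
    and nxt: "\<And>x. nxt Y x p = (if x i then a else b)"
  shows "safe Y V t p \<longleftrightarrow> (0 \<le> V i \<longrightarrow> safe Y V t a) \<and> (V i \<le> 0 \<longrightarrow> safe Y V t b)"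
proof -
  have step: "fin Y x p = fin Y x (if x i then a else b)" for x
    using fin_step[of p Y x] p nxt by (simp add: reads_of_def)
  have upd: "fin Y (x(i := c)) q = fin Y x q" if "V i = 0" "p < q" for x c q
  proof (rule fin_cong)
    fix r j assume "q \<le> r" "r \<in> reads_of Y j"
    moreover have "r = p" if "r \<in> reads_of Y i"
      using once \<open>V i = 0\<close> p that card_le_Suc0_iff_eq[of "reads_of Y i"]
      by (auto simp: free_once_def)
    ultimately show "(x(i := c)) j = x j"
      using \<open>p < q\<close> by auto
  qed
  have gt: "p < a" "p < b"
    using nxt_gt[of p Y "\<lambda>_. True"] nxt_gt[of p Y "\<lambda>_. False"] nxt by simp_all
  have cons: "consistent V (x(i := c))" if "consistent V x" "V i = 0" for x c
    using that by (auto simp: consistent_def)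
  show ?thesis
  proof (intro iffI conjI impI)
    assume s: "safe Y V t p"
    show "safe Y V t a" if "0 \<le> V i"
      unfolding safe_def
    proof (intro allI impI)
      fix x assume x: "consistent V x"
      show "fin Y x a = t"
      proof (cases "V i = 0")
        case True
        have "fin Y (x(i := True)) p = t"
          using s cons[OF x True] by (simp add: safe_def)
        then show ?thesis
          using upd[OF True gt(1), of x True] step[of "x(i := True)"] by simp
      next
        case False
        then have "x i"
          using x that by (simp add: consistent_def)
        then show ?thesis
          using s x step[of x] by (simp add: safe_def)
      qed
    qed
    show "safe Y V t b" if "V i \<le> 0"
      unfolding safe_def
    proof (intro allI impI)
      fix x assume x: "consistent V x"
      show "fin Y x b = t"
      proof (cases "V i = 0")
        case True
        have "fin Y (x(i := False)) p = t"
          using s cons[OF x True] by (simp add: safe_def)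
        then show ?thesis
          using upd[OF True gt(2), of x False] step[of "x(i := False)"] by simp
      next
        case False
        then have "\<not> x i"
          using x that by (simp add: consistent_def)
        then show ?thesis
          using s x step[of x] by (simp add: safe_def)
      qed
    qed
  next
    assume *: "(0 \<le> V i \<longrightarrow> safe Y V t a) \<and> (V i \<le> 0 \<longrightarrow> safe Y V t b)"
    show "safe Y V t p"
      unfolding safe_def
    proof (intro allI impI)
      fix x assume x: "consistent V x"
      then have "x i \<longrightarrow> 0 \<le> V i" "\<not> x i \<longrightarrow> V i \<le> 0"
        by (auto simp: consistent_def not_less[symmetric])
      then show "fin Y x p = t"
        using * x step[of x] by (auto simp: safe_def)
    qed
  qed
qed

definition pattern :: "nat set \<Rightarrow> nat set \<Rightarrow> nat \<Rightarrow> int" where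
  "pattern R A i = (if i \<in> R then if i \<in> A then 1 else - 1 else 0)"

text \<open>A nonzero input either is nonzero on \<open>R\<close> or is zero on \<open>R\<close> with some other register set.\<close>

lemma nonzero_test_iff_safe:
  assumes R: "R \<subseteq> {1..n}"
  shows "nonzero_test Y n \<longleftrightarrow>
    safe Y (pattern {1..n} {}) (length Y + 1) 0 \<and>
    (\<forall>i\<in>{1..n}. safe Y ((pattern R {})(i := 1)) (length Y) 0) \<and>
    (\<forall>A. A \<subseteq> R \<and> A \<noteq> {} \<longrightarrow> safe Y (pattern R A) (length Y) 0)"
    (is "_ \<longleftrightarrow> ?zero \<and> ?unit \<and> ?rest")
proof (intro iffI conjI)
  assume nz: "nonzero_test Y n"
  show ?zero
    unfolding safe_def
  proof (intro allI impI)
    fix x assume "consistent (pattern {1..n} {}) x"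
    then have "\<not> x i" if "i \<in> {1..n}" for i
      using that by (auto simp: consistent_def pattern_def split: if_splits)
    then show "fin Y x 0 = length Y + 1"
      using nz by (simp add: nonzero_test_def)
  qed
  show ?unit
    unfolding safe_def
  proof (intro ballI allI impI)
    fix i x assume i: "i \<in> {1..n}" and "consistent ((pattern R {})(i := 1)) x"
    then have "x i"
      unfolding consistent_def by (metis fun_upd_same zero_less_one)
    then show "fin Y x 0 = length Y"
      using nz i unfolding nonzero_test_def by (metis (full_types))
  qed
  show ?rest
    unfolding safe_def
  proof (intro allI impI)
    fix A x assume A: "A \<subseteq> R \<and> A \<noteq> {}" and x: "consistent (pattern R A) x"
    then obtain i where "i \<in> A" "i \<in> R"
      by blast
    then have "pattern R A i > 0"
      by (simp add: pattern_def)
    then have "x i" "i \<in> {1..n}"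
      using R \<open>i \<in> R\<close> x by (auto simp: consistent_def)
    then show "fin Y x 0 = length Y"
      using nz unfolding nonzero_test_def by (metis (full_types))
  qed
next
  assume *: "?zero \<and> ?unit \<and> ?rest"
  then have rest: ?rest
    by (elim conjE)
  show "nonzero_test Y n"
    unfolding nonzero_test_def
  proof
    fix x
    show "fin Y x 0 = (if \<exists>i\<in>{1..n}. x i then length Y else length Y + 1)"
    proof (cases "\<exists>i\<in>{1..n}. x i")
      case False
      then have "consistent (pattern {1..n} {}) x"
        by (auto simp: consistent_def pattern_def)
      then have "fin Y x 0 = length Y + 1"
        using * by (simp add: safe_def)
      then show ?thesis
        using False by (simp only: if_False)
    next
      case True
      then obtain i where i: "i \<in> {1..n}" "x i"
        by blast
      have "fin Y x 0 = length Y"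
      proof (cases "{j \<in> R. x j} = {}")
        case True
        then have "consistent ((pattern R {})(i := 1)) x"
          using i by (auto simp: consistent_def pattern_def)
        then show ?thesis
          using * i by (auto simp: safe_def)
      next
        case False
        have "consistent (pattern R {j \<in> R. x j}) x"
          by (auto simp: consistent_def pattern_def)
        moreover have "safe Y (pattern R {j \<in> R. x j}) (length Y) 0"
          using rest[rule_format, of "{j \<in> R. x j}"] False by auto
        ultimately show ?thesis
          by (simp add: safe_def)
      qed
      then show ?thesis
        using True by (simp only: if_True)
    qed
  qed
qed

section \<open>A structured language compiled to random access machines\<close>

datatype var = vN | vM | vK | vP | vQ | vF | vA | vU | vV | vX | vY | vR | vT | vI | vS | vC | vE
  | vOk | vOne | vTwo | vNeg | vZero

datatype arr = Form | Param | Count | Value | Flag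

datatype com =
    Const var int
  | Add var var var
  | Sub var var var
  | Load var arr var
  | Store arr var var
  | Read var
  | Print var
  | Skip
  | Seq com com (infixr ";;" 60)
  | Cond var com com
  | Loop var com

record st =
  sc :: "var \<Rightarrow> int"
  ar :: "arr \<Rightarrow> nat \<Rightarrow> int"
  inp :: "int list"
  outp :: "int list"
  clk :: nat

text \<open>The clock counts an upper bound of the steps of the compiled code.\<close>

inductive run :: "com \<Rightarrow> st \<Rightarrow> st \<Rightarrow> bool" where
  run_Const: "run (Const v k) s (s\<lparr>sc := (sc s)(v := k), clk := clk s + 1\<rparr>)"
| run_Add: "run (Add v j k) s (s\<lparr>sc := (sc s)(v := sc s j + sc s k), clk := clk s + 1\<rparr>)"
| run_Sub: "run (Sub v j k) s (s\<lparr>sc := (sc s)(v := sc s j - sc s k), clk := clk s + 1\<rparr>)"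
| run_Load: "0 \<le> sc s j \<Longrightarrow>
    run (Load v a j) s (s\<lparr>sc := (sc s)(v := ar s a (nat (sc s j))), clk := clk s + 6\<rparr>)"
| run_Store: "0 \<le> sc s j \<Longrightarrow>
    run (Store a j v) s
      (s\<lparr>ar := (ar s)(a := (ar s a)(nat (sc s j) := sc s v)), clk := clk s + 6\<rparr>)"
| run_Read: "inp s = i # is \<Longrightarrow>
    run (Read v) s (s\<lparr>sc := (sc s)(v := i), inp := is, clk := clk s + 1\<rparr>)"
| run_Print: "run (Print v) s (s\<lparr>outp := outp s @ [sc s v], clk := clk s + 1\<rparr>)"
| run_Skip: "run Skip s s"
| run_Seq: "\<lbrakk>run c s s'; run d s' s''\<rbrakk> \<Longrightarrow> run (c ;; d) s s''"
| run_Cond: "run (if 0 < sc s v then c else d) (s\<lparr>clk := clk s + 3\<rparr>) s' \<Longrightarrow> run (Cond v c d) s s'"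
| run_Loop_end: "\<not> 0 < sc s v \<Longrightarrow> run (Loop v c) s (s\<lparr>clk := clk s + 3\<rparr>)"
| run_Loop_step: "\<lbrakk>0 < sc s v; run c (s\<lparr>clk := clk s + 3\<rparr>) s'; run (Loop v c) s' s''\<rbrakk>
    \<Longrightarrow> run (Loop v c) s s''"

inductive_simps run_simps:
  "run (Const v k) s s'" "run (Add v j k) s s'" "run (Sub v j k) s s'" "run (Load v a j) s s'"
  "run (Store a j v) s s'" "run (Read v) s s'" "run (Print v) s s'" "run Skip s s'"
  "run (c ;; d) s s'" "run (Cond v c d) s s'"

section \<open>Total correctness with running time\<close>

definition wp :: "com \<Rightarrow> (st \<Rightarrow> bool) \<Rightarrow> st \<Rightarrow> bool" where
  "wp c Q s \<longleftrightarrow> (\<exists>s'. run c s s' \<and> Q s')"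

lemma wp_simps:
  "wp (Const v k) Q s \<longleftrightarrow> Q (s\<lparr>sc := (sc s)(v := k), clk := clk s + 1\<rparr>)"
  "wp (Add v i j) Q s \<longleftrightarrow> Q (s\<lparr>sc := (sc s)(v := sc s i + sc s j), clk := clk s + 1\<rparr>)"
  "wp (Sub v i j) Q s \<longleftrightarrow> Q (s\<lparr>sc := (sc s)(v := sc s i - sc s j), clk := clk s + 1\<rparr>)"
  "wp (Load v a j) Q s \<longleftrightarrow>
    0 \<le> sc s j \<and> Q (s\<lparr>sc := (sc s)(v := ar s a (nat (sc s j))), clk := clk s + 6\<rparr>)"
  "wp (Store a j v) Q s \<longleftrightarrow> 0 \<le> sc s j \<and>
    Q (s\<lparr>ar := (ar s)(a := (ar s a)(nat (sc s j) := sc s v)), clk := clk s + 6\<rparr>)"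
  "wp (Print v) Q s \<longleftrightarrow> Q (s\<lparr>outp := outp s @ [sc s v], clk := clk s + 1\<rparr>)"
  "wp Skip Q s \<longleftrightarrow> Q s"
  "wp (c ;; d) Q s \<longleftrightarrow> wp c (wp d Q) s"
  "wp (Cond v c d) Q s \<longleftrightarrow>
    (if 0 < sc s v then wp c Q (s\<lparr>clk := clk s + 3\<rparr>) else wp d Q (s\<lparr>clk := clk s + 3\<rparr>))"
  by (auto simp: wp_def run_simps)

lemma wp_Read:
  "wp (Read v) Q s \<longleftrightarrow> inp s \<noteq> [] \<and>
    Q (s\<lparr>sc := (sc s)(v := hd (inp s)), inp := tl (inp s), clk := clk s + 1\<rparr>)"
  by (cases "inp s") (auto simp: wp_def run_simps)

lemma wp_mono: "\<lbrakk>wp c Q s; \<And>s'. Q s' \<Longrightarrow> Q' s'\<rbrakk> \<Longrightarrow> wp c Q' s"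
  unfolding wp_def by blast

lemma wp_SeqI: "\<lbrakk>wp c Q s; \<And>s'. Q s' \<Longrightarrow> wp d Q' s'\<rbrakk> \<Longrightarrow> wp (c ;; d) Q' s"
  by (auto simp: wp_simps intro: wp_mono)

text \<open>The index of the invariant is the termination measure. It may drop by more than one,
  which \<open>increment\<close> and \<open>check_all\<close> need in order to leave their loops
  early.\<close>

lemma wp_Loop:
  fixes I :: "nat \<Rightarrow> st \<Rightarrow> bool"
  assumes "I k s"
    and step: "\<And>k s. \<lbrakk>I k s; 0 < sc s v\<rbrakk> \<Longrightarrow> wp c (\<lambda>s'. \<exists>k'<k. I k' s') (s\<lparr>clk := clk s + 3\<rparr>)"
    and exit: "\<And>k s. \<lbrakk>I k s; \<not> 0 < sc s v\<rbrakk> \<Longrightarrow> Q (s\<lparr>clk := clk s + 3\<rparr>)"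
  shows "wp (Loop v c) Q s"
  using \<open>I k s\<close>
proof (induction k arbitrary: s rule: less_induct)
  case (less k)
  show ?case
  proof (cases "0 < sc s v")
    case True
    then obtain k' s' where s': "run c (s\<lparr>clk := clk s + 3\<rparr>) s'" "k' < k" "I k' s'"
      using step[OF less.prems] unfolding wp_def by blast
    then obtain s'' where "run (Loop v c) s' s''" "Q s''"
      using less.IH[of k' s'] unfolding wp_def by blast
    then show ?thesis
      using s' True unfolding wp_def by (blast intro: run_Loop_step)
  next
    case False
    then show ?thesis
      using exit[OF less.prems] unfolding wp_def by (blast intro: run_Loop_end)
  qed
qed

section \<open>Memory layout and compilation\<close>

primrec var_reg :: "var \<Rightarrow> nat" where
  "var_reg vN = 2" | "var_reg vM = 3" | "var_reg vK = 4" | "var_reg vP = 5" | "var_reg vQ = 6"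
| "var_reg vF = 7" | "var_reg vA = 8" | "var_reg vU = 9" | "var_reg vV = 10" | "var_reg vX = 11"
| "var_reg vY = 12" | "var_reg vR = 13" | "var_reg vT = 14" | "var_reg vI = 15" | "var_reg vS = 16"
| "var_reg vC = 17" | "var_reg vE = 18" | "var_reg vOk = 19" | "var_reg vOne = 20"
| "var_reg vTwo = 21" | "var_reg vNeg = 22" | "var_reg vZero = 23"

primrec arr_base :: "arr \<Rightarrow> nat" where
  "arr_base Form = 24" | "arr_base Param = 25" | "arr_base Count = 26" | "arr_base Value = 27"
| "arr_base Flag = 28"

text \<open>The unbounded arrays are interleaved. The stride 8 is a power of two, so an address
  takes three doublings instead of a multiplication, and the bases 24 to 28 lie above all scalars
  and differ modulo 8.\<close>

definition arr_reg :: "arr \<Rightarrow> nat \<Rightarrow> nat" where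
  "arr_reg a p = arr_base a + 8 * p"

lemma var_reg_bounds: "2 \<le> var_reg v" "var_reg v < 24"
  by (cases v; simp)+

lemma arr_base_bounds: "24 \<le> arr_base a" "arr_base a < 32"
  by (cases a; simp)+

lemma var_reg_eq_iff [simp]: "var_reg v = var_reg w \<longleftrightarrow> v = w"
  by (cases v; cases w; simp)

lemma arr_base_eq_iff: "arr_base a = arr_base b \<longleftrightarrow> a = b"
  by (cases a; cases b; simp)

lemma arr_reg_eq_iff [simp]: "arr_reg a p = arr_reg b q \<longleftrightarrow> a = b \<and> p = q"
proof -
  have "a = b \<and> p = q" if "arr_reg a p = arr_reg b q"
  proof -
    have "p = q" and "arr_base a = arr_base b"
      using that arr_base_bounds[of a] arr_base_bounds[of b] unfolding arr_reg_def by presburger+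
    then show ?thesis
      by (simp add: arr_base_eq_iff)
  qed
  then show ?thesis
    by blast
qed

lemma reg_neqs [simp]:
  "var_reg v \<noteq> arr_reg a p" "arr_reg a p \<noteq> var_reg v" "var_reg v \<noteq> 0" "var_reg v \<noteq> Suc 0"
  "arr_reg a p \<noteq> 0" "arr_reg a p \<noteq> Suc 0"
  using var_reg_bounds[of v] arr_base_bounds[of a] by (auto simp: arr_reg_def)

text \<open>Registers 0 and 1 are scratch: they hold the address of an array cell, and register 0 is set
  to 1 before an unconditional jump.\<close>

definition address :: "arr \<Rightarrow> var \<Rightarrow> ram_instr list" where
  "address a j = [RAdd 0 (var_reg j) (var_reg j), RAdd 0 0 0, RAdd 0 0 0,
     RConst 1 (int (arr_base a)), RAdd 0 0 1]"

primrec csize :: "com \<Rightarrow> nat" where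
  "csize (Const v k) = 1"
| "csize (Add v j k) = 1"
| "csize (Sub v j k) = 1"
| "csize (Load v a j) = 6"
| "csize (Store a j v) = 6"
| "csize (Read v) = 1"
| "csize (Print v) = 1"
| "csize Skip = 0"
| "csize (c ;; d) = csize c + csize d"
| "csize (Cond v c d) = csize c + csize d + 3"
| "csize (Loop v c) = csize c + 5"

text \<open>Jump targets are absolute, hence the load address \<open>q\<close>. \<open>RTra\<close>
  is a conditional jump, so the alternative for a nonpositive test comes first, and an unconditional
  jump takes two instructions. Test and jump together are the three ticks charged for
  \<open>Cond\<close>, for a round of \<open>Loop\<close> and for leaving it.\<close>

primrec compile :: "nat \<Rightarrow> com \<Rightarrow> ram_prog" where
  "compile q (Const v k) = [RConst (var_reg v) k]"
| "compile q (Add v i j) = [RAdd (var_reg v) (var_reg i) (var_reg j)]"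
| "compile q (Sub v i j) = [RSub (var_reg v) (var_reg i) (var_reg j)]"
| "compile q (Load v a j) = address a j @ [RLoad (var_reg v) 0]"
| "compile q (Store a j v) = address a j @ [RStore 0 (var_reg v)]"
| "compile q (Read v) = [RRead (var_reg v)]"
| "compile q (Print v) = [RPrint (var_reg v)]"
| "compile q Skip = []"
| "compile q (c ;; d) = compile q c @ compile (q + csize c) d"
| "compile q (Cond v c d) = [RTra (q + csize d + 3) (var_reg v)] @ compile (q + 1) d @
     [RConst 0 1, RTra (q + csize (Cond v c d)) 0] @ compile (q + csize d + 3) c"
| "compile q (Loop v c) = [RTra (q + 3) (var_reg v), RConst 0 1, RTra (q + csize (Loop v c)) 0] @
     compile (q + 3) c @ [RConst 0 1, RTra q 0]"

lemma length_compile [simp]: "length (compile q c) = csize c"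
  by (induction c arbitrary: q) (auto simp: address_def)

primrec code_at :: "ram_prog \<Rightarrow> nat \<Rightarrow> ram_instr list \<Rightarrow> bool" where
  "code_at P q [] \<longleftrightarrow> True"
| "code_at P q (i # is) \<longleftrightarrow> q < length P \<and> P ! q = i \<and> code_at P (Suc q) is"

lemma code_at_append [simp]:
  "code_at P q (is @ js) \<longleftrightarrow> code_at P q is \<and> code_at P (q + length is) js"
  by (induction "is" arbitrary: q) auto

lemma code_at_self: "code_at P 0 P"
proof -
  have "code_at (js @ is) (length js) is" for js "is"
  proof (induction "is" arbitrary: js)
    case (Cons i "is")
    then show ?case
      using Cons[of "js @ [i]"] by simp
  qed simp
  from this[of "[]"] show ?thesis
    by simp
qed

section \<open>Simulation of the structured language on the machine\<close>

definition reach :: "ram_prog \<Rightarrow> ram_config \<Rightarrow> nat \<Rightarrow> ram_config \<Rightarrow> bool" where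
  "reach P \<sigma> t \<sigma>' \<longleftrightarrow> (\<exists>t'\<le>t. (ram_step P ^^ t') \<sigma> \<sigma>')"

lemma reach_refl: "reach P \<sigma> t \<sigma>"
  unfolding reach_def by (intro exI[of _ 0]) simp

lemma reach_trans: "\<lbrakk>reach P \<sigma> t \<sigma>'; reach P \<sigma>' t' \<sigma>''; t + t' \<le> u\<rbrakk> \<Longrightarrow> reach P \<sigma> u \<sigma>''"
  unfolding reach_def by (metis add_mono order_trans relcompp_apply relpowp_add)

lemma reach_step:
  assumes "ram_pc \<sigma> < length P" "ram_instr_step (P ! ram_pc \<sigma>) \<sigma> = Some \<sigma>'" "0 < t"
  shows "reach P \<sigma> t \<sigma>'"
  using assms unfolding reach_def by (intro exI[of _ 1]) (simp add: ram_step_def relcompp_apply Suc_le_eq)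

definition represents :: "st \<Rightarrow> ram_config \<Rightarrow> nat \<Rightarrow> bool" where
  "represents s \<sigma> q \<longleftrightarrow> ram_pc \<sigma> = q \<and> (\<forall>v. ram_reg \<sigma> (var_reg v) = sc s v) \<and>
     (\<forall>a p. ram_reg \<sigma> (arr_reg a p) = ar s a p) \<and> ram_in \<sigma> = inp s \<and> ram_out \<sigma> = outp s"

lemma represents_scratch:
  "represents s \<sigma> q \<Longrightarrow>
    represents s (\<sigma>\<lparr>ram_pc := q', ram_reg := (ram_reg \<sigma>)(0 := x)\<rparr>) q'"
  by (simp add: represents_def)

lemma represents_clk [simp]: "represents (s\<lparr>clk := k\<rparr>) \<sigma> q \<longleftrightarrow> represents s \<sigma> q"
  by (simp add: represents_def)

lemma reach_jump:
  assumes "code_at P q [RConst 0 1, RTra q' 0]" and "represents s \<sigma> q"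
  obtains \<sigma>' where "reach P \<sigma> 2 \<sigma>'" "represents s \<sigma>' q'"
proof -
  let ?\<sigma>1 = "\<sigma>\<lparr>ram_pc := Suc q, ram_reg := (ram_reg \<sigma>)(0 := 1)\<rparr>"
  let ?\<sigma>2 = "\<sigma>\<lparr>ram_pc := q', ram_reg := (ram_reg \<sigma>)(0 := 1)\<rparr>"
  have "reach P \<sigma> 1 ?\<sigma>1" "reach P ?\<sigma>1 1 ?\<sigma>2"
    using assms by (auto intro!: reach_step simp: represents_def)
  then have "reach P \<sigma> 2 ?\<sigma>2"
    by (rule reach_trans) simp
  then show thesis
    using that represents_scratch[OF assms(2)] by blast
qed

lemma reach_test:
  assumes "code_at P q [RTra q' (var_reg v)]" and "represents s \<sigma> q"
  obtains \<sigma>' where "reach P \<sigma> 1 \<sigma>'" "represents s \<sigma>' (if 0 < sc s v then q' else q + 1)"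
proof
  show "reach P \<sigma> 1 (\<sigma>\<lparr>ram_pc := if 0 < sc s v then q' else q + 1\<rparr>)"
    using assms by (intro reach_step) (auto simp: represents_def)
  show "represents s (\<sigma>\<lparr>ram_pc := if 0 < sc s v then q' else q + 1\<rparr>)
      (if 0 < sc s v then q' else q + 1)"
    using assms by (simp add: represents_def)
qed

lemma reach_address:
  assumes "code_at P q (address a j)" and rep: "represents s \<sigma> q" and "0 \<le> sc s j"
  obtains \<sigma>' where "reach P \<sigma> 5 \<sigma>'" "represents s \<sigma>' (q + 5)"
    "ram_reg \<sigma>' 0 = int (arr_reg a (nat (sc s j)))"
proof -
  let ?x = "sc s j"
  let ?b = "int (arr_base a)"
  define \<tau> where "\<tau> k x = \<sigma>\<lparr>ram_pc := k, ram_reg := (ram_reg \<sigma>)(0 := x)\<rparr>" for k x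
  define \<tau>' where "\<tau>' k x = \<sigma>\<lparr>ram_pc := k, ram_reg := (ram_reg \<sigma>)(0 := x, 1 := ?b)\<rparr>" for k x
  have "reach P \<sigma> 1 (\<tau> (q + 1) (2 * ?x))"
    using assms by (intro reach_step) (auto simp: represents_def address_def \<tau>_def)
  moreover have "reach P (\<tau> (q + 1) (2 * ?x)) 1 (\<tau> (q + 2) (4 * ?x))"
    using assms by (intro reach_step) (auto simp: address_def \<tau>_def)
  moreover have "reach P (\<tau> (q + 2) (4 * ?x)) 1 (\<tau> (q + 3) (8 * ?x))"
    using assms by (intro reach_step) (auto simp: address_def \<tau>_def eval_nat_numeral)
  moreover have "reach P (\<tau> (q + 3) (8 * ?x)) 1 (\<tau>' (q + 4) (8 * ?x))"
    using assms by (intro reach_step) (auto simp: address_def \<tau>_def \<tau>'_def eval_nat_numeral)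
  moreover have "reach P (\<tau>' (q + 4) (8 * ?x)) 1 (\<tau>' (q + 5) (8 * ?x + ?b))"
    using assms by (intro reach_step) (auto simp: address_def \<tau>'_def eval_nat_numeral fun_upd_twist)
  ultimately have "reach P \<sigma> (1 + 1 + 1 + 1 + 1) (\<tau>' (q + 5) (8 * ?x + ?b))"
    by (meson reach_trans order_refl)
  moreover have "represents s (\<tau>' (q + 5) (8 * ?x + ?b)) (q + 5)"
    using rep by (simp add: represents_def \<tau>'_def)
  moreover have "ram_reg (\<tau>' (q + 5) (8 * ?x + ?b)) 0 = int (arr_reg a (nat ?x))"
    using assms(3) by (simp add: \<tau>'_def arr_reg_def)
  ultimately show thesis
    using that by (simp add: eval_nat_numeral)
qed

text \<open>Monotonicity of the clock is carried through the induction because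
  \<open>clk s' - clk s\<close> is a truncated difference of natural numbers.\<close>

theorem compile_correct:
  assumes "run c s s'" "code_at P q (compile q c)" "represents s \<sigma> q"
  shows "clk s \<le> clk s' \<and> (\<exists>\<sigma>'. reach P \<sigma> (clk s' - clk s) \<sigma>' \<and> represents s' \<sigma>' (q + csize c))"
  using assms
proof (induction arbitrary: q \<sigma> rule: run.induct)
  case (run_Const v k s)
  then show ?case
    by (auto simp: represents_def intro!: reach_step exI)
next
  case (run_Add v j k s)
  then show ?case
    by (auto simp: represents_def intro!: reach_step exI)
next
  case (run_Sub v j k s)
  then show ?case
    by (auto simp: represents_def intro!: reach_step exI)
next
  case (run_Load s j v a)
  obtain \<sigma>1 where \<sigma>1: "reach P \<sigma> 5 \<sigma>1" "represents s \<sigma>1 (q + 5)"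
    "ram_reg \<sigma>1 0 = int (arr_reg a (nat (sc s j)))"
    using run_Load reach_address[of P q a j s \<sigma>] by auto
  let ?\<sigma>2 = "\<sigma>1\<lparr>ram_pc := q + 6, ram_reg := (ram_reg \<sigma>1)(var_reg v := ar s a (nat (sc s j)))\<rparr>"
  have "reach P \<sigma>1 1 ?\<sigma>2"
    using run_Load \<sigma>1 by (intro reach_step) (auto simp: represents_def address_def eval_nat_numeral)
  then have "reach P \<sigma> 6 ?\<sigma>2"
    using \<sigma>1(1) reach_trans by fastforce
  moreover have "represents (s\<lparr>sc := (sc s)(v := ar s a (nat (sc s j))), clk := clk s + 6\<rparr>) ?\<sigma>2 (q + 6)"
    using \<sigma>1(2) by (simp add: represents_def)
  ultimately show ?case
    by auto
next
  case (run_Store s j a v)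
  obtain \<sigma>1 where \<sigma>1: "reach P \<sigma> 5 \<sigma>1" "represents s \<sigma>1 (q + 5)"
    "ram_reg \<sigma>1 0 = int (arr_reg a (nat (sc s j)))"
    using run_Store reach_address[of P q a j s \<sigma>] by auto
  let ?\<sigma>2 = "\<sigma>1\<lparr>ram_pc := q + 6, ram_reg := (ram_reg \<sigma>1)(arr_reg a (nat (sc s j)) := sc s v)\<rparr>"
  have "reach P \<sigma>1 1 ?\<sigma>2"
    using run_Store \<sigma>1 by (intro reach_step) (auto simp: represents_def address_def eval_nat_numeral)
  then have "reach P \<sigma> 6 ?\<sigma>2"
    using \<sigma>1(1) reach_trans by fastforce
  moreover have "represents (s\<lparr>ar := (ar s)(a := (ar s a)(nat (sc s j) := sc s v)), clk := clk s + 6\<rparr>)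
      ?\<sigma>2 (q + 6)"
    using \<sigma>1(2) by (auto simp: represents_def)
  ultimately show ?case
    by auto
next
  case (run_Read s i "is" v)
  then show ?case
    by (auto simp: represents_def intro!: reach_step exI)
next
  case (run_Print v s)
  then show ?case
    by (auto simp: represents_def intro!: reach_step exI)
next
  case (run_Skip s)
  then show ?case
    by (auto intro: reach_refl)
next
  case (run_Seq c s s' d s'')
  obtain \<sigma>1 where \<sigma>1: "clk s \<le> clk s'" "reach P \<sigma> (clk s' - clk s) \<sigma>1" "represents s' \<sigma>1 (q + csize c)"
    using run_Seq.IH(1)[of q \<sigma>] run_Seq.prems by auto
  obtain \<sigma>2 where \<sigma>2: "clk s' \<le> clk s''" "reach P \<sigma>1 (clk s'' - clk s') \<sigma>2"
    "represents s'' \<sigma>2 (q + csize c + csize d)"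
    using run_Seq.IH(2)[OF _ \<sigma>1(3)] run_Seq.prems by auto
  have "reach P \<sigma> (clk s'' - clk s) \<sigma>2"
    using \<sigma>1(2) \<sigma>2(2) by (rule reach_trans) (use \<sigma>1(1) \<sigma>2(1) in simp)
  then show ?case
    using \<sigma>1(1) \<sigma>2 by (auto simp: add.assoc)
next
  case (run_Cond s v c d s')
  have code: "code_at P (q + csize d + 3) (compile (q + csize d + 3) c)"
    using run_Cond.prems by (simp add: numeral_3_eq_3)
  obtain \<sigma>1 where \<sigma>1: "reach P \<sigma> 1 \<sigma>1"
    "represents s \<sigma>1 (if 0 < sc s v then q + csize d + 3 else q + 1)"
    using run_Cond.prems reach_test[of P q "q + csize d + 3" v s \<sigma>] by auto
  show ?case
  proof (cases "0 < sc s v")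
    case True
    then obtain \<sigma>2 where \<sigma>2: "clk s + 3 \<le> clk s'" "reach P \<sigma>1 (clk s' - (clk s + 3)) \<sigma>2"
      "represents s' \<sigma>2 (q + csize d + 3 + csize c)"
      using run_Cond.IH[of "q + csize d + 3" \<sigma>1] code \<sigma>1 by auto
    have "reach P \<sigma> (clk s' - clk s) \<sigma>2"
      using \<sigma>1(1) \<sigma>2(2) by (rule reach_trans) (use \<sigma>2(1) in simp)
    then show ?thesis
      using \<sigma>2 by (auto simp: ac_simps)
  next
    case False
    then obtain \<sigma>2 where \<sigma>2: "clk s + 3 \<le> clk s'" "reach P \<sigma>1 (clk s' - (clk s + 3)) \<sigma>2"
      "represents s' \<sigma>2 (q + 1 + csize d)"
      using run_Cond.IH[of "q + 1" \<sigma>1] run_Cond.prems \<sigma>1 by auto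
    obtain \<sigma>3 where \<sigma>3: "reach P \<sigma>2 2 \<sigma>3" "represents s' \<sigma>3 (q + csize (Cond v c d))"
      by (rule reach_jump[OF _ \<sigma>2(3)]) (use run_Cond.prems in auto)
    have "reach P \<sigma> (1 + (clk s' - (clk s + 3))) \<sigma>2"
      using \<sigma>1(1) \<sigma>2(2) by (rule reach_trans) simp
    then have "reach P \<sigma> (clk s' - clk s) \<sigma>3"
      using \<sigma>3(1) by (rule reach_trans) (use \<sigma>2(1) in simp)
    then show ?thesis
      using \<sigma>2 \<sigma>3 by auto
  qed
next
  case (run_Loop_end s v c)
  obtain \<sigma>1 where \<sigma>1: "reach P \<sigma> 1 \<sigma>1" "represents s \<sigma>1 (q + 1)"
    using run_Loop_end reach_test[of P q "q + 3" v s \<sigma>] by auto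
  obtain \<sigma>2 where \<sigma>2: "reach P \<sigma>1 2 \<sigma>2" "represents s \<sigma>2 (q + csize (Loop v c))"
    by (rule reach_jump[OF _ \<sigma>1(2)]) (use run_Loop_end.prems in auto)
  have "reach P \<sigma> 3 \<sigma>2"
    using \<sigma>1(1) \<sigma>2(1) by (rule reach_trans) simp
  then show ?case
    using \<sigma>2 by auto
next
  case (run_Loop_step s v c s' s'')
  have code: "code_at P (q + 3) (compile (q + 3) c)"
    using run_Loop_step.prems by (simp add: numeral_3_eq_3)
  obtain \<sigma>1 where \<sigma>1: "reach P \<sigma> 1 \<sigma>1" "represents s \<sigma>1 (q + 3)"
    using run_Loop_step.hyps run_Loop_step.prems reach_test[of P q "q + 3" v s \<sigma>] by auto
  obtain \<sigma>2 where \<sigma>2: "clk s + 3 \<le> clk s'" "reach P \<sigma>1 (clk s' - (clk s + 3)) \<sigma>2"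
    "represents s' \<sigma>2 (q + 3 + csize c)"
    using run_Loop_step.IH(1)[of "q + 3" \<sigma>1] code \<sigma>1 by auto
  obtain \<sigma>3 where \<sigma>3: "reach P \<sigma>2 2 \<sigma>3" "represents s' \<sigma>3 q"
    by (rule reach_jump[OF _ \<sigma>2(3)]) (use run_Loop_step.prems in \<open>auto simp: numeral_3_eq_3\<close>)
  obtain \<sigma>4 where \<sigma>4: "clk s' \<le> clk s''" "reach P \<sigma>3 (clk s'' - clk s') \<sigma>4"
    "represents s'' \<sigma>4 (q + csize (Loop v c))"
    using run_Loop_step.IH(2)[of q \<sigma>3] run_Loop_step.prems \<sigma>3 by auto
  have "reach P \<sigma> (1 + (clk s' - (clk s + 3))) \<sigma>2"
    using \<sigma>1(1) \<sigma>2(2) by (rule reach_trans) simp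
  then have "reach P \<sigma> (clk s' - clk s) \<sigma>3"
    using \<sigma>3(1) by (rule reach_trans) (use \<sigma>2(1) in simp)
  then have "reach P \<sigma> (clk s'' - clk s) \<sigma>4"
    using \<sigma>4(2) by (rule reach_trans) (use \<sigma>2(1) \<sigma>4(1) in simp)
  then show ?case
    using \<sigma>2(1) \<sigma>4 by auto
qed

definition st_init :: "int list \<Rightarrow> st" where
  "st_init zs = \<lparr>sc = (\<lambda>_. 0), ar = (\<lambda>_ _. 0), inp = zs, outp = [], clk = 0\<rparr>"

text \<open>The simulation ends at \<open>csize c\<close>, the length of the program, and passing to
  that nonexistent line is how the machine halts.\<close>

corollary ram_decides_within_compile:
  assumes "wp c (\<lambda>s. outp s = [if Q then 1 else 0] \<and> clk s \<le> t) (st_init zs)"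
  shows "ram_decides_within (compile 0 c) zs Q t"
proof -
  obtain s where s: "run c (st_init zs) s" "outp s = [if Q then 1 else 0]" "clk s \<le> t"
    using assms unfolding wp_def by blast
  have "represents (st_init zs) (ram_init zs) 0"
    by (simp add: represents_def st_init_def ram_init_def)
  then obtain \<sigma> where \<sigma>: "reach (compile 0 c) (ram_init zs) (clk s) \<sigma>" "represents s \<sigma> (csize c)"
    using compile_correct[OF s(1) code_at_self] by (auto simp: st_init_def)
  then obtain t' where "t' \<le> clk s" "(ram_step (compile 0 c) ^^ t') (ram_init zs) \<sigma>"
    unfolding reach_def by blast
  then show ?thesis
    using \<sigma>(2) s unfolding ram_decides_within_def ram_halts_with_def represents_def
    by (intro exI[of _ t']) auto
qed

section \<open>The decision procedure\<close>

text \<open>Computes \<open>safe\<close> backwards in the array \<open>Flag\<close>. A negative test is treated as a positive test of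
  the negated value. Jumps out of the program read a cell that is never written, hence 0.\<close>

definition check_body :: com where
  "check_body =
     Sub vP vP vOne ;; Load vF Form vP ;; Load vA Param vP ;; Sub vU vF vTwo ;;
     Cond vU
       (Add vQ vP vA ;; Load vR Flag vQ)
       (Load vV Value vA ;; Sub vU vF vOne ;; Cond vU (Sub vV vZero vV) Skip ;;
        Add vQ vP vOne ;; Load vX Flag vQ ;; Add vQ vQ vOne ;; Load vY Flag vQ ;; Const vR 1 ;;
        Add vU vV vOne ;; Cond vU (Cond vX Skip (Const vR 0)) Skip ;;
        Sub vU vOne vV ;; Cond vU (Cond vY Skip (Const vR 0)) Skip) ;;
     Store Flag vP vR"

text \<open>\<open>vT\<close> selects the wanted exit: 1 for \<open>out.set:1\<close>, 0 for
  \<open>!\<close>. \<open>vOk\<close> is only ever lowered, so it accumulates the verdicts of all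
  passes.\<close>

definition check :: com where
  "check =
     (Add vQ vK vOne ;; Store Flag vK vT ;; Sub vU vOne vT ;; Store Flag vQ vU ;;
      Add vP vK vZero) ;;
     Loop vP check_body ;;
     Load vR Flag vP ;; Cond vR Skip (Const vOk 0)"

definition fill :: com where
  "fill = Add vI vN vZero ;; Loop vI (Store Value vI vNeg ;; Sub vI vI vOne)"

definition release :: com where
  "release = Add vI vN vZero ;;
     Loop vI (Load vX Count vI ;; Sub vX vX vOne ;; Cond vX Skip (Store Value vI vZero) ;;
       Sub vI vI vOne)"

text \<open>\<open>vS\<close> is needed because the old value is -1 or 0 according to whether the
  register is read more than once.\<close>

definition check_units :: com where
  "check_units = Add vI vN vZero ;;
     Loop vI (Load vS Value vI ;; Store Value vI vOne ;; check ;; Store Value vI vS ;;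
       Sub vI vI vOne)"

text \<open>A binary counter whose digits are the registers with \<open>Count\<close> above 1, with
  -1 as digit 0. Digits 1 are cleared until a digit 0 is found; setting it ends the loop through
  \<open>vI = 0\<close> and reports success in \<open>vC\<close>. On overflow \<open>vC\<close>
  remains 0.\<close>

definition increment :: com where
  "increment = Add vI vN vZero ;; Const vC 0 ;;
     Loop vI (Load vX Count vI ;; Sub vX vX vOne ;;
       Cond vX
         (Load vX Value vI ;;
          Cond vX (Store Value vI vNeg ;; Sub vI vI vOne)
            (Store Value vI vOne ;; Const vI 0 ;; Const vC 1))
         (Sub vI vI vOne))"

text \<open>Incrementing before the first check skips the empty set, which the other passes have
  dealt with; overflow ends the loop.\<close>

definition check_all :: com where
  "check_all = Const vC 1 ;; Loop vC (increment ;; Cond vC check Skip)"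

text \<open>Forms below 3 are the instructions on input registers, here always tests. The end of the
  input is recognised by form 19, the final \<open>!\<close>.\<close>

definition read_body :: com where
  "read_body =
     Read vF ;; Read vA ;; Store Form vP vF ;; Store Param vP vA ;; Const vU 3 ;; Sub vU vU vF ;;
     Cond vU (Load vX Count vA ;; Add vX vX vOne ;; Store Count vA vX ;; Add vE vE vOne) Skip ;;
     Add vP vP vOne ;; Const vU 19 ;; Sub vC vU vF"

definition read_input :: com where
  "read_input =
     (Read vN ;; Read vM ;; Const vOne 1 ;; Const vTwo 2 ;; Const vNeg (- 1) ;; Const vC 1) ;;
     Loop vC read_body ;; Sub vK vP vTwo"

definition search :: com where
  "search = Const vOk 1 ;; fill ;; check ;; release ;; Const vT 1 ;; check_units ;; check_all"

text \<open>\<open>vX\<close> becomes \<open>6 * m\<close> by additions. When the search is skipped,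
  \<open>vOk\<close> still has its initial value 0, which is the rejection.\<close>

definition decide_tstnz :: com where
  "decide_tstnz =
     read_input ;;
     (Sub vU vE vN ;; Add vX vM vM ;; Add vX vX vM ;; Add vX vX vX ;; Sub vU vU vX) ;;
     Cond vU Skip search ;;
     Print vOk"

section \<open>Correctness and cost of a single pass\<close>

definition env :: "prim_instr list \<Rightarrow> nat \<Rightarrow> st \<Rightarrow> bool" where
  "env Y n s \<longleftrightarrow>
     sc s vN = int n \<and> sc s vK = int (length Y) \<and> sc s vOne = 1 \<and> sc s vTwo = 2 \<and>
     sc s vNeg = - 1 \<and> sc s vZero = 0 \<and>
     (\<forall>p<length Y. [ar s Form p, ar s Param p] = encode_prim (Y ! p)) \<and>
     (\<forall>i. ar s Count i = int (card (reads_of Y i))) \<and>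
     (\<forall>p\<ge>length Y + 2. ar s Flag p = 0) \<and> outp s = []"

definition unchanged :: "var set \<Rightarrow> arr set \<Rightarrow> st \<Rightarrow> st \<Rightarrow> bool" where
  "unchanged W B s s' \<longleftrightarrow>
     (\<forall>v. v \<notin> W \<longrightarrow> sc s' v = sc s v) \<and> (\<forall>a. a \<notin> B \<longrightarrow> ar s' a = ar s a) \<and> outp s' = outp s"

abbreviation check_vars :: "var set" where
  "check_vars \<equiv> {vP, vQ, vF, vA, vU, vV, vX, vY, vR}"

text \<open>In \<open>Y\<close> the form is 1 for a positive test, 2 for a negative one and 18 for a
  jump, so the signs of form - 2 and form - 1 separate the cases. For values -1, 0, 1 the tests
  \<open>V + 1 > 0\<close> and \<open>1 - V > 0\<close> are the two premises of
  \<open>safe_read\<close>.\<close>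

lemma wp_check_body:
  assumes Y: "reads_and_jumps Y" and env: "env Y n s" and p: "p < length Y"
    and P: "sc s vP = int (Suc p)"
    and V: "ar s Value = V" "free_once Y V" "\<forall>i. V i \<in> {- 1, 0, 1}"
    and flag: "\<forall>q>p. ar s Flag q = of_bool (safe Y V t q)"
  shows "wp check_body (\<lambda>s'. unchanged check_vars {Flag} s s' \<and> sc s' vP = int p \<and>
      (\<forall>q\<ge>p. ar s' Flag q = of_bool (safe Y V t q)) \<and>
      (\<forall>q. q \<noteq> p \<longrightarrow> ar s' Flag q = ar s Flag q) \<and> clk s' \<le> clk s + 70) s"
proof -
  have [simp]: "nat (int p + 1) = Suc p" "nat (2 + int p) = Suc (Suc p)"
    "nat (int p + int l) = p + l" for l
    by auto
  have fp: "[ar s Form p, ar s Param p] = encode_prim (Y ! p)"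
    and const: "sc s vOne = 1" "sc s vTwo = 2" "sc s vZero = 0"
    using env p by (auto simp: env_def)
  have ge: "(\<forall>q\<ge>p. ((ar s Flag)(p := x)) q = of_bool (safe Y V t q)) \<longleftrightarrow> x = of_bool (safe Y V t p)"
    for x :: int
    using flag by (auto simp: le_less)
  from Y p show ?thesis
  proof (cases rule: reads_and_jumps_cases)
    case (1 i)
    have "safe Y V t p \<longleftrightarrow> (0 \<le> V i \<longrightarrow> safe Y V t (Suc p)) \<and> (V i \<le> 0 \<longrightarrow> safe Y V t (Suc (Suc p)))"
      using V 1 p by (intro safe_read) (auto simp: reads_of_def read_instr_def nxt_def)
    moreover have "V i = - 1 \<or> V i = 0 \<or> V i = 1"
      using V by auto
    ultimately show ?thesis
      using fp const P 1 flag V(1) unfolding check_body_def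
      by (elim disjE) (simp_all add: wp_simps unchanged_def ge)
  next
    case (2 i)
    have "safe Y V t p \<longleftrightarrow> (0 \<le> V i \<longrightarrow> safe Y V t (Suc (Suc p))) \<and> (V i \<le> 0 \<longrightarrow> safe Y V t (Suc p))"
      using V 2 p by (intro safe_read) (auto simp: reads_of_def read_instr_def nxt_def)
    moreover have "V i = - 1 \<or> V i = 0 \<or> V i = 1"
      using V by auto
    ultimately show ?thesis
      using fp const P 2 flag V(1) unfolding check_body_def
      by (elim disjE) (simp_all add: wp_simps unchanged_def ge)
  next
    case (3 l)
    then have "safe Y V t p \<longleftrightarrow> safe Y V t (p + l)"
      using p by (intro safe_jump) auto
    then show ?thesis
      using fp const P 3 flag V(1) unfolding check_body_def
      by (simp add: wp_simps unchanged_def ge)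
  qed
qed

lemma env_clk [simp]: "env Y n (s\<lparr>clk := k\<rparr>) \<longleftrightarrow> env Y n s"
  by (simp add: env_def)

lemma wp_check:
  assumes Y: "reads_and_jumps Y" and env: "env Y n s"
    and V: "ar s Value = V" "free_once Y V" "\<forall>i. V i \<in> {- 1, 0, 1}"
    and T: "sc s vT = of_bool b" and t: "t = (if b then length Y else length Y + 1)"
    and ok: "sc s vOk = of_bool c"
  shows "wp check (\<lambda>s'. unchanged (insert vOk check_vars) {Flag} s s' \<and> env Y n s' \<and>
      sc s' vOk = of_bool (c \<and> safe Y V t 0) \<and> clk s' \<le> clk s + 80 * length Y + 60) s"
proof -
  let ?K = "length Y"
  \<comment> \<open>\<open>d\<close> is the slack of the time bound: 20 covers the set-up, 23 also
    the three ticks for leaving the loop.\<close>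
  define I where "I d k s' \<longleftrightarrow> unchanged check_vars {Flag} s s' \<and> sc s' vP = int k \<and> k \<le> ?K \<and>
      (\<forall>q\<ge>k. ar s' Flag q = of_bool (safe Y V t q)) \<and> clk s' + 80 * k \<le> clk s + 80 * ?K + d" for d k s'
  \<comment> \<open>Positions from \<open>?K + 2\<close> on differ from both exits, so by
    \<open>safe_end\<close> their flags are 0.\<close>
  have env': "env Y n s'" if "I d k s'" for d k s'
    using that env safe_end[of Y _ V t] t
    by (auto simp: I_def env_def unchanged_def)
  have [simp]: "nat (int ?K + 1) = Suc ?K"
    by simp
  show ?thesis
    unfolding check_def
  proof (rule wp_SeqI[of _ "I 20 ?K"], goal_cases)
    case 1
    have "(((ar s Flag)(?K := of_bool b, Suc ?K := 1 - of_bool b)) q) = of_bool (safe Y V t q)"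
      if "?K \<le> q" for q
      using that env t safe_end[OF that, of V t] by (auto simp: env_def)
    then show ?case
      using env T by (simp add: wp_simps I_def unchanged_def env_def)
  next
    case (2 s1)
    show ?case
    proof (rule wp_SeqI[of _ "I 23 0"], goal_cases)
      case 1
      show ?case
      proof (rule wp_Loop[of "I 20", OF 2])
        fix k s' assume I: "I 20 k s'" and pos: "0 < sc s' vP"
        then obtain p where k: "k = Suc p"
          by (cases k) (auto simp: I_def)
        let ?s = "s'\<lparr>clk := clk s' + 3\<rparr>"
        have "wp check_body (\<lambda>s''. unchanged check_vars {Flag} ?s s'' \<and> sc s'' vP = int p \<and>
          (\<forall>q\<ge>p. ar s'' Flag q = of_bool (safe Y V t q)) \<and>
          (\<forall>q. q \<noteq> p \<longrightarrow> ar s'' Flag q = ar ?s Flag q) \<and> clk s'' \<le> clk ?s + 70) ?s"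
          using env'[OF I] I k V by (intro wp_check_body[OF Y]) (auto simp: I_def unchanged_def)
        then show "wp check_body (\<lambda>s''. \<exists>k'<k. I 20 k' s'') ?s"
          by (rule wp_mono) (use I k in \<open>auto simp: I_def unchanged_def\<close>)
      next
        fix k s' assume "I 20 k s'" and "\<not> 0 < sc s' vP"
        then show "I 23 0 (s'\<lparr>clk := clk s' + 3\<rparr>)"
          by (auto simp: I_def unchanged_def)
      qed
    next
      case (2 s2)
      have "unchanged check_vars {Flag} s s2" "sc s2 vP = 0" "sc s2 vOk = of_bool c"
        "ar s2 Flag 0 = of_bool (safe Y V t 0)" "clk s2 \<le> clk s + 80 * ?K + 23"
        using 2 ok by (auto simp: I_def unchanged_def)
      then show ?case
        using env'[OF 2] by (auto simp: wp_simps env_def unchanged_def)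
    qed
  qed
qed

lemma reads_of_iregs: "p \<in> reads_of Y i \<Longrightarrow> i \<in> iregs Y"
  unfolding reads_of_def iregs_def using nth_mem by blast

lemma free_once_pattern:
  assumes "iregs Y \<subseteq> {1..n}" and "\<forall>i\<in>{1..n}. 2 \<le> card (reads_of Y i) \<longrightarrow> i \<in> R"
  shows "free_once Y (pattern R A)"
  unfolding free_once_def
proof (intro allI impI)
  fix i assume "pattern R A i = 0"
  then have "i \<notin> R"
    by (auto simp: pattern_def split: if_splits)
  moreover have "reads_of Y i = {}" if "i \<notin> {1..n}"
    using assms(1) that reads_of_iregs by blast
  ultimately show "card (reads_of Y i) \<le> 1"
    using assms(2) by (metis card.empty le_0_eq linorder_linear not_less_eq_eq one_add_one plus_1_eq_Suc)
qed

lemma free_once_upd: "free_once Y V \<Longrightarrow> k \<noteq> 0 \<Longrightarrow> free_once Y (V(i := k))"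
  by (simp add: free_once_def)

lemma pattern_range: "pattern R A i \<in> {- 1, 0, 1}"
  by (simp add: pattern_def)

lemma nat_1_plus_int [simp]: "nat (1 + int j) = Suc j"
  by simp

section \<open>Initial assignments and the passes with one register set\<close>

lemma wp_fill:
  assumes "env Y n s" and "ar s Value = (\<lambda>_. 0)"
  shows "wp fill (\<lambda>s'. env Y n s' \<and> sc s' vOk = sc s vOk \<and> sc s' vT = sc s vT \<and>
      ar s' Value = pattern {1..n} {} \<and> clk s' \<le> clk s + 20 * n + 20) s"
proof -
  define I where "I i s' \<longleftrightarrow> env Y n s' \<and> sc s' vOk = sc s vOk \<and> sc s' vT = sc s vT \<and>
    sc s' vI = int i \<and> i \<le> n \<and> ar s' Value = pattern {i<..n} {} \<and>
    clk s' + 20 * i \<le> clk s + 20 * n + 5" for i s'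
  show ?thesis
    unfolding fill_def
  proof (rule wp_SeqI[of _ "I n"], goal_cases)
    case 1
    then show ?case
      using assms by (auto simp: wp_simps I_def env_def pattern_def)
  next
    case (2 s1)
    show ?case
    proof (rule wp_Loop[of I, OF 2], goal_cases)
      case (1 i s')
      then obtain j where i: "i = Suc j"
        by (cases i) (auto simp: I_def)
      have "(pattern {Suc j<..n} {})(Suc j := - 1) = pattern {j<..n} {}"
        using 1 by (auto simp: pattern_def i I_def fun_eq_iff)
      then show ?case
        using 1 by (auto simp: wp_simps I_def i env_def intro!: exI[of _ j])
    next
      case (2 i s')
      then show ?case
        by (auto simp: I_def atLeastSucAtMost_greaterThanAtMost[symmetric])
    qed
  qed
qed

definition multi :: "prim_instr list \<Rightarrow> nat \<Rightarrow> nat set" where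
  "multi Y n = {i \<in> {1..n}. 2 \<le> card (reads_of Y i)}"

lemma wp_release:
  assumes "env Y n s" and "ar s Value = pattern {1..n} {}"
  shows "wp release (\<lambda>s'. env Y n s' \<and> sc s' vOk = sc s vOk \<and>
      ar s' Value = pattern (multi Y n) {} \<and> clk s' \<le> clk s + 30 * n + 20) s"
proof -
  define I where "I i s' \<longleftrightarrow> env Y n s' \<and> sc s' vOk = sc s vOk \<and>
    sc s' vI = int i \<and> i \<le> n \<and> ar s' Value = pattern ({1..i} \<union> multi Y n) {} \<and>
    clk s' + 30 * i \<le> clk s + 30 * n + 5" for i s'
  show ?thesis
    unfolding release_def
  proof (rule wp_SeqI[of _ "I n"], goal_cases)
    case 1
    have "{1..n} = {1..n} \<union> multi Y n"
      by (auto simp: multi_def)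
    then show ?case
      using assms by (auto simp: wp_simps I_def env_def)
  next
    case (2 s1)
    show ?case
    proof (rule wp_Loop[of I, OF 2], goal_cases)
      case (1 i s')
      then obtain j where i: "i = Suc j"
        by (cases i) (auto simp: I_def)
      show ?case
      proof (cases "2 \<le> card (reads_of Y (Suc j))")
        case True
        then have "{1..Suc j} \<union> multi Y n = {1..j} \<union> multi Y n"
          using 1 by (auto simp: multi_def I_def i le_Suc_eq)
        moreover have "0 < int (card (reads_of Y (Suc j))) - 1"
          using True by simp
        ultimately show ?thesis
          using 1 by (auto simp: wp_simps I_def i env_def intro!: exI[of _ j])
      next
        case False
        then have "(pattern ({1..Suc j} \<union> multi Y n) {})(Suc j := 0) = pattern ({1..j} \<union> multi Y n) {}"
          by (auto simp: pattern_def multi_def fun_eq_iff)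
        moreover have "\<not> 0 < int (card (reads_of Y (Suc j))) - 1"
          using False by simp
        ultimately show ?thesis
          using 1 by (auto simp: wp_simps I_def i env_def intro!: exI[of _ j])
      qed
    next
      case (2 i s')
      then show ?case
        by (auto simp: I_def)
    qed
  qed
qed

lemma wp_check_units:
  assumes Y: "reads_and_jumps Y" and ir: "iregs Y \<subseteq> {1..n}" and env: "env Y n s"
    and V: "ar s Value = pattern (multi Y n) {}"
    and T: "sc s vT = 1" and ok: "sc s vOk = of_bool c"
  shows "wp check_units (\<lambda>s'. env Y n s' \<and> ar s' Value = pattern (multi Y n) {} \<and> sc s' vT = 1 \<and>
      sc s' vOk = of_bool (c \<and> (\<forall>i\<in>{1..n}. safe Y ((pattern (multi Y n) {})(i := 1)) (length Y) 0)) \<and>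
      clk s' \<le> clk s + n * (80 * length Y + 100) + 20) s"
proof -
  let ?V = "pattern (multi Y n) {}"
  define I where "I i s' \<longleftrightarrow> env Y n s' \<and> ar s' Value = ?V \<and> sc s' vT = 1 \<and>
    sc s' vI = int i \<and> i \<le> n \<and>
    sc s' vOk = of_bool (c \<and> (\<forall>j\<in>{i<..n}. safe Y (?V(j := 1)) (length Y) 0)) \<and>
    clk s' + i * (80 * length Y + 100) \<le> clk s + n * (80 * length Y + 100) + 5" for i s'
  show ?thesis
    unfolding check_units_def
  proof (rule wp_SeqI[of _ "I n"], goal_cases)
    case 1
    show ?case
      using env V T ok by (auto simp: wp_simps I_def env_def)
  next
    case (2 s1)
    show ?case
    proof (rule wp_Loop[of I, OF 2], goal_cases)
      case (1 i s')
      then obtain j where i: "i = Suc j"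
        by (cases i) (auto simp: I_def)
      define c' where "c' \<longleftrightarrow> c \<and> (\<forall>j\<in>{i<..n}. safe Y (?V(j := 1)) (length Y) 0)"
      have "{j<..n} = insert i {i<..n}"
        using 1 by (auto simp: I_def i)
      then have c'': "(c \<and> (\<forall>j\<in>{j<..n}. safe Y (?V(j := 1)) (length Y) 0)) \<longleftrightarrow>
          c' \<and> safe Y (?V(i := 1)) (length Y) 0"
        by (auto simp: c'_def)
      \<comment> \<open>The state in which \<open>check\<close> starts; 15 is the loop test and two
        array accesses.\<close>
      define s2 where "s2 = s'\<lparr>sc := (sc s')(vS := ?V i),
        ar := (ar s')(Value := ?V(i := 1)), clk := clk s' + 15\<rparr>"
      have s2: "env Y n s2" "ar s2 Value = ?V(i := 1)" "sc s2 vT = of_bool True"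
        "sc s2 vOk = of_bool c'"
        using 1 by (auto simp: I_def env_def s2_def c'_def)
      have "free_once Y (?V(i := 1))" "\<forall>k. (?V(i := 1)) k \<in> {- 1, 0, 1}"
        using ir pattern_range[of "multi Y n" "{}"]
        by (auto intro!: free_once_upd free_once_pattern simp: multi_def)
      then have "wp check (\<lambda>s3. unchanged (insert vOk check_vars) {Flag} s2 s3 \<and> env Y n s3 \<and>
          sc s3 vOk = of_bool (c' \<and> safe Y (?V(i := 1)) (length Y) 0) \<and>
          clk s3 \<le> clk s2 + 80 * length Y + 60) s2"
        using s2 by (intro wp_check[OF Y, where b = True]) auto
      then have "wp check (wp (Store Value vI vS ;; Sub vI vI vOne) (\<lambda>s'. \<exists>k'<i. I k' s')) s2"
      proof (rule wp_mono, goal_cases)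
        case (1 s3)
        then have "sc s3 vI = int i" "sc s3 vS = ?V i" "sc s3 vT = 1" "ar s3 Value = ?V(i := 1)"
          "clk s3 \<le> clk s' + 80 * length Y + 75" "env Y n s3"
          "sc s3 vOk = of_bool (c' \<and> safe Y (?V(i := 1)) (length Y) 0)"
          using \<open>I i s'\<close> by (auto simp: unchanged_def s2_def I_def)
        then show ?case
          using \<open>I i s'\<close> c''
          by (auto simp: wp_simps env_def I_def i algebra_simps intro!: exI[of _ j])
      qed
      moreover have "sc s' vI = int i" "sc s' vOne = 1" "ar s' Value = ?V"
        using 1 by (auto simp: I_def env_def)
      ultimately show ?case
        by (simp add: wp_simps s2_def add.commute)
    next
      case (2 i s')
      then show ?case
        by (auto simp: I_def atLeastSucAtMost_greaterThanAtMost[symmetric])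
    qed
  qed
qed

section \<open>Enumerating the subsets of \<open>multi Y n\<close> by a binary counter\<close>

definition rank :: "nat set \<Rightarrow> nat \<Rightarrow> nat" where
  "rank R i = card {j \<in> R. i < j}"

text \<open>The number whose binary digits are the bits of \<open>A \<subseteq> R\<close>; the largest register is the least
  significant one, because \<open>increment\<close> runs downwards.\<close>

definition bin_value :: "nat set \<Rightarrow> nat set \<Rightarrow> nat" where
  "bin_value R A = (\<Sum>i\<in>A. 2 ^ rank R i)"

lemma rank_less: "\<lbrakk>finite R; i \<in> R\<rbrakk> \<Longrightarrow> rank R i < card R"
  unfolding rank_def by (rule psubset_card_mono) auto

lemma rank_inj: "finite R \<Longrightarrow> inj_on (rank R) R"
proof (rule linorder_inj_onI)
  fix i j assume "finite R" "i < j" "i \<in> R" "j \<in> R"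
  then have "rank R j < rank R i"
    unfolding rank_def by (intro psubset_card_mono) auto
  then show "rank R i \<noteq> rank R j"
    by simp
qed auto

text \<open>Ranks are distinct on \<open>R\<close>, so uniqueness of binary representations carries
  over from \<open>set_encode\<close>.\<close>

lemma bin_value_eq_set_encode:
  assumes "finite R" "A \<subseteq> R"
  shows "bin_value R A = set_encode (rank R ` A)"
  using inj_on_subset[OF rank_inj[OF assms(1)] assms(2)]
  by (simp add: bin_value_def set_encode_def sum.reindex)

lemma bin_value_less:
  assumes "finite R" "A \<subseteq> R"
  shows "bin_value R A < 2 ^ card R"
proof -
  have "bin_value R A = (\<Sum>k\<in>rank R ` A. 2 ^ k)"
    using bin_value_eq_set_encode[OF assms] by (simp add: set_encode_def)
  also have "\<dots> \<le> (\<Sum>k\<in>{..<card R}. 2 ^ k)"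
    using assms rank_less by (intro sum_mono2) auto
  also have "\<dots> = 2 ^ card R - 1"
    by (simp add: lessThan_atLeast0 sum_power2)
  also have "\<dots> < 2 ^ card R"
    by simp
  finally show ?thesis .
qed

lemma bin_value_inj:
  assumes "finite R" "A \<subseteq> R" "B \<subseteq> R" "bin_value R A = bin_value R B"
  shows "A = B"
proof -
  have "finite A" "finite B"
    using assms finite_subset by auto
  then have "rank R ` A = rank R ` B"
    using assms by (auto simp: bin_value_eq_set_encode set_encode_eq)
  then show ?thesis
    using inj_on_image_eq_iff[OF rank_inj[OF assms(1)] assms(2,3)] by simp
qed

lemma bin_value_0_iff: "\<lbrakk>finite R; A \<subseteq> R\<rbrakk> \<Longrightarrow> bin_value R A = 0 \<longleftrightarrow> A = {}"
  using bin_value_inj[of R A "{}"] by (auto simp: bin_value_def)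

lemma pattern_upd:
  assumes "i \<in> R"
  shows "(pattern R A)(i := 1) = pattern R (insert i A)" "(pattern R A)(i := - 1) = pattern R (A - {i})"
  using assms by (auto simp: pattern_def fun_eq_iff)

lemma wp_increment:
  assumes env: "env Y n s" and A: "A \<subseteq> multi Y n" and V: "ar s Value = pattern (multi Y n) A"
  shows "wp increment (\<lambda>s'. env Y n s' \<and> sc s' vOk = sc s vOk \<and> sc s' vT = sc s vT \<and>
      (\<exists>B. B \<subseteq> multi Y n \<and> ar s' Value = pattern (multi Y n) B \<and>
        (sc s' vC = 1 \<and> bin_value (multi Y n) B = bin_value (multi Y n) A + 1 \<or>
         sc s' vC = 0 \<and> bin_value (multi Y n) B + 2 ^ card (multi Y n) = bin_value (multi Y n) A + 1)) \<and>
      clk s' \<le> clk s + 40 * n + 20) s"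
proof -
  let ?R = "multi Y n"
  have fin: "finite ?R"
    by (simp add: multi_def)
  \<comment> \<open>With \<open>x = 0\<close> a carry is pending at the next digit at or below
    \<open>i\<close>; its weight is \<open>2 ^ rank ?R i\<close>, and \<open>bin_value ?R B\<close>
    lacks just this from the successor. With \<open>x = 1\<close> the carry has been absorbed. A
    carry pending at \<open>i = 0\<close> has weight \<open>2 ^ card ?R\<close>, which is
    overflow.\<close>
  define J where "J i B x \<longleftrightarrow> B \<subseteq> ?R \<and>
    (x = (1::int) \<and> i = 0 \<and> bin_value ?R B = bin_value ?R A + 1 \<or>
     x = 0 \<and> bin_value ?R B + 2 ^ rank ?R i = bin_value ?R A + 1)" for i B x
  define I where "I i s' \<longleftrightarrow> env Y n s' \<and> sc s' vOk = sc s vOk \<and> sc s' vT = sc s vT \<and>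
    sc s' vI = int i \<and> i \<le> n \<and> (\<exists>B. ar s' Value = pattern ?R B \<and> J i B (sc s' vC)) \<and>
    clk s' + 40 * i \<le> clk s + 40 * n + 5" for i s'
  show ?thesis
    unfolding increment_def
  proof (subst wp_simps(8), subst wp_simps(2), rule wp_SeqI[of _ "I n"], goal_cases)
    case 1
    have none: "{j \<in> ?R. n < j} = {}"
      by (auto simp: multi_def)
    have "rank ?R n = 0"
      unfolding rank_def none by simp
    then have "J n A 0"
      using A by (simp add: J_def)
    then show ?case
      using env V by (auto simp: wp_simps I_def env_def)
  next
    case (2 s1)
    show ?case
    proof (rule wp_Loop[of I, OF 2], goal_cases)
      case (1 i s')
      then obtain j where i: "i = Suc j"
        by (cases i) (auto simp: I_def)
      then obtain B where B: "ar s' Value = pattern ?R B" "B \<subseteq> ?R" "sc s' vC = 0"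
        "bin_value ?R B + 2 ^ rank ?R i = bin_value ?R A + 1"
        using 1 by (auto simp: I_def J_def)
      have s': "env Y n s'" "sc s' vOk = sc s vOk" "sc s' vT = sc s vT" "sc s' vI = int (Suc j)" "Suc j \<le> n"
        "clk s' + 40 * Suc j \<le> clk s + 40 * n + 5"
        using 1 i by (auto simp: I_def)
      have finB: "finite B"
        using B(2) fin finite_subset by blast
      show ?case
      proof (cases "2 \<le> card (reads_of Y (Suc j))")
        case multi: True
        then have iR: "Suc j \<in> ?R"
          using s' by (simp add: multi_def)
        have test: "0 < int (card (reads_of Y (Suc j))) - 1"
          using multi by simp
        show ?thesis
        proof (cases "Suc j \<in> B")
          case True
          \<comment> \<open>Clearing the digit at \<open>Suc j\<close> removes
            \<open>2 ^ rank ?R i\<close> and doubles the weight of the carry.\<close>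
          have "{k \<in> ?R. j < k} = insert (Suc j) {k \<in> ?R. Suc j < k}"
            using iR by auto
          then have "rank ?R j = Suc (rank ?R i)"
            using fin by (simp add: rank_def i)
          moreover have "bin_value ?R B = 2 ^ rank ?R i + bin_value ?R (B - {Suc j})"
            using finB True by (simp add: bin_value_def sum.remove i)
          ultimately have "J j (B - {Suc j}) 0"
            using B by (auto simp: J_def)
          moreover have "pattern ?R B (Suc j) = 1"
            using True iR by (simp add: pattern_def)
          ultimately show ?thesis
            using B s' test by (auto simp: wp_simps I_def i env_def pattern_upd[OF iR] intro!: exI[of _ j])
        next
          case False
          then have "bin_value ?R (insert (Suc j) B) = bin_value ?R B + 2 ^ rank ?R i"
            using finB by (simp add: bin_value_def i)
          then have "J 0 (insert (Suc j) B) 1"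
            using B iR by (auto simp: J_def)
          moreover have "pattern ?R B (Suc j) = - 1"
            using False iR by (simp add: pattern_def)
          ultimately show ?thesis
            using B s' test by (auto simp: wp_simps I_def i env_def pattern_upd[OF iR] intro!: exI[of _ 0])
        qed
      next
        case False
        then have "{k \<in> ?R. j < k} = {k \<in> ?R. Suc j < k}"
          by (auto simp: multi_def) (metis Suc_lessI)
        then have "J j B 0"
          using B by (simp add: J_def rank_def i)
        moreover have "\<not> 0 < int (card (reads_of Y (Suc j))) - 1"
          using False by simp
        ultimately show ?thesis
          using B s' by (auto simp: wp_simps I_def i env_def intro!: exI[of _ j])
      qed
    next
      case (2 i s')
      have "{j \<in> ?R. 0 < j} = ?R"
        by (auto simp: multi_def)
      then have "rank ?R 0 = card ?R"
        by (simp add: rank_def)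
      then show ?case
        using 2 by (auto simp: I_def J_def)
    qed
  qed
qed

lemma wp_check_all:
  assumes Y: "reads_and_jumps Y" and ir: "iregs Y \<subseteq> {1..n}" and env: "env Y n s"
    and V: "ar s Value = pattern (multi Y n) {}"
    and T: "sc s vT = 1" and ok: "sc s vOk = of_bool c"
  shows "wp check_all (\<lambda>s'. env Y n s' \<and>
      sc s' vOk = of_bool (c \<and> (\<forall>A. A \<subseteq> multi Y n \<and> A \<noteq> {} \<longrightarrow>
        safe Y (pattern (multi Y n) A) (length Y) 0)) \<and>
      clk s' \<le> clk s + 2 ^ card (multi Y n) * (80 * length Y + 40 * n + 100) + 20) s"
proof -
  let ?R = "multi Y n"
  let ?S = "\<lambda>A. safe Y (pattern ?R A) (length Y) 0"
  let ?b = "bin_value ?R"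
  define W where "W = 80 * length Y + 40 * n + 100"
  have fin: "finite ?R"
    by (simp add: multi_def)
  \<comment> \<open>The verdict once the counter has passed from 0 to the value of
    \<open>A\<close>.\<close>
  define S where "S A \<longleftrightarrow> c \<and> (\<forall>B. B \<subseteq> ?R \<and> B \<noteq> {} \<and> ?b B \<le> ?b A \<longrightarrow> ?S B)" for A
  define all where "all \<longleftrightarrow> c \<and> (\<forall>A. A \<subseteq> ?R \<and> A \<noteq> {} \<longrightarrow> ?S A)"
  \<comment> \<open>\<open>k\<close> is the number of increments still to come, the overflowing one
    included; thus the budget is \<open>W\<close> per increment.\<close>
  define I where "I k s' \<longleftrightarrow> env Y n s' \<and> sc s' vT = 1 \<and>
    (\<exists>A. A \<subseteq> ?R \<and> ar s' Value = pattern ?R A \<and>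
      (sc s' vC = 1 \<and> k + ?b A = 2 ^ card ?R \<and> sc s' vOk = of_bool (S A) \<or>
       sc s' vC = 0 \<and> k = 0 \<and> sc s' vOk = of_bool all)) \<and>
    clk s' + k * W \<le> clk s + 2 ^ card ?R * W + 5" for k s'
  show ?thesis
    unfolding check_all_def W_def[symmetric] all_def[symmetric]
  proof (rule wp_SeqI[of _ "I (2 ^ card ?R)"], goal_cases)
    case 1
    have "S {} \<longleftrightarrow> c"
      using bin_value_0_iff[OF fin] by (auto simp: S_def bin_value_def)
    moreover have "?b {} = 0"
      by (simp add: bin_value_def)
    ultimately show ?case
      using env V T ok by (auto simp: wp_simps I_def env_def intro!: exI[of _ "{}"])
  next
    case (2 s1)
    show ?case
    proof (rule wp_Loop[of I, OF 2], goal_cases)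
      case (1 k s')
      then obtain A where A: "A \<subseteq> ?R" "ar s' Value = pattern ?R A" "k + ?b A = 2 ^ card ?R"
        "sc s' vOk = of_bool (S A)"
        by (auto simp: I_def)
      then obtain l where k: "k = Suc l"
        using bin_value_less[OF fin A(1)] by (cases k) auto
      let ?s = "s'\<lparr>clk := clk s' + 3\<rparr>"
      have s': "env Y n ?s" "sc s' vT = 1" "clk s' + Suc l * W \<le> clk s + 2 ^ card ?R * W + 5"
        using 1 k by (auto simp: I_def)
      show ?case
      proof (rule wp_SeqI[OF wp_increment[OF s'(1) A(1)]], goal_cases)
        case 1
        then show ?case
          using A by simp
      next
        case (2 s2)
        then obtain B where B: "B \<subseteq> ?R" "ar s2 Value = pattern ?R B"
          "sc s2 vC = 1 \<and> ?b B = ?b A + 1 \<or> sc s2 vC = 0 \<and> ?b B + 2 ^ card ?R = ?b A + 1"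
          by auto
        have s2: "env Y n s2" "sc s2 vOk = of_bool (S A)" "sc s2 vT = 1" "clk s2 \<le> clk s' + 40 * n + 23"
          using 2 A(4) s'(2) by auto
        from B(3) show ?case
        proof
          assume inc: "sc s2 vC = 1 \<and> ?b B = ?b A + 1"
          then have "B \<noteq> {}"
            by (auto simp: bin_value_def)
          have "S B \<longleftrightarrow> S A \<and> ?S B"
          proof
            assume "S B"
            then show "S A \<and> ?S B"
              using inc B(1) \<open>B \<noteq> {}\<close> by (auto simp: S_def)
          next
            assume SA: "S A \<and> ?S B"
            have "?S D" if "D \<subseteq> ?R" "D \<noteq> {}" "?b D \<le> ?b B" for D
            proof (cases "?b D = ?b B")
              case True
              then show ?thesis
                using bin_value_inj[OF fin that(1) B(1)] SA by auto
            next
              case False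
              then show ?thesis
                using SA that inc by (auto simp: S_def)
            qed
            then show "S B"
              using SA by (auto simp: S_def)
          qed
          let ?s2 = "s2\<lparr>clk := clk s2 + 3\<rparr>"
          have "free_once Y (pattern ?R B)"
            using ir by (intro free_once_pattern) (auto simp: multi_def)
          then have "wp check (\<lambda>s3. unchanged (insert vOk check_vars) {Flag} ?s2 s3 \<and> env Y n s3 \<and>
              sc s3 vOk = of_bool (S A \<and> ?S B) \<and> clk s3 \<le> clk ?s2 + 80 * length Y + 60) ?s2"
            using s2 B pattern_range[of ?R B] by (intro wp_check[OF Y, where b = True]) auto
          then have "wp check (\<lambda>s3. \<exists>k'<k. I k' s3) ?s2"
          proof (rule wp_mono, goal_cases)
            case (1 s3)
            then have "I l s3"
              using s2 s'(3) B inc A(3) k \<open>S B \<longleftrightarrow> S A \<and> ?S B\<close>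
              by (auto simp: I_def unchanged_def W_def intro!: exI[of _ B])
            then show ?case
              using k by blast
          qed
          then show ?thesis
            using inc by (simp add: wp_simps)
        next
          assume stop: "sc s2 vC = 0 \<and> ?b B + 2 ^ card ?R = ?b A + 1"
          \<comment> \<open>Overflow means that \<open>A\<close> had the greatest possible value, so
            every subset has been covered.\<close>
          have "?b D \<le> ?b A" if "D \<subseteq> ?R" for D
            using bin_value_less[OF fin that] stop by linarith
          then have "S A \<longleftrightarrow> all"
            by (auto simp: S_def all_def)
          then have "I 0 (s2\<lparr>clk := clk s2 + 3\<rparr>)"
            using s2 s'(3) B(1,2) stop by (auto simp: I_def W_def)
          then show ?thesis
            using stop k by (auto simp: wp_simps)
        qed
      qed
    next
      case (2 k s')
      then show ?case
        by (auto simp: I_def)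
    qed
  qed
qed

lemma wp_search:
  assumes Y: "reads_and_jumps Y" and ir: "iregs Y \<subseteq> {1..n}" and env: "env Y n s"
    and V: "ar s Value = (\<lambda>_. 0)" and T: "sc s vT = 0"
  shows "wp search (\<lambda>s'. env Y n s' \<and> sc s' vOk = of_bool (nonzero_test Y n) \<and>
      clk s' \<le> clk s + (50 * n + 80 * length Y + 200) + n * (80 * length Y + 100) +
        2 ^ card (multi Y n) * (80 * length Y + 40 * n + 100)) s"
proof -
  let ?R = "multi Y n"
  let ?K = "length Y"
  define c0 where "c0 \<longleftrightarrow> safe Y (pattern {1..n} {}) (?K + 1) 0"
  define c1 where "c1 \<longleftrightarrow> c0 \<and> (\<forall>i\<in>{1..n}. safe Y ((pattern ?R {})(i := 1)) ?K 0)"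
  have "?R \<subseteq> {1..n}"
    by (auto simp: multi_def)
  then have nz: "nonzero_test Y n \<longleftrightarrow> c1 \<and> (\<forall>A. A \<subseteq> ?R \<and> A \<noteq> {} \<longrightarrow> safe Y (pattern ?R A) ?K 0)"
    unfolding c1_def c0_def using nonzero_test_iff_safe[of ?R n Y] by (simp only: conj_assoc)
  define Q where "Q V t b k s' \<longleftrightarrow> env Y n s' \<and> ar s' Value = V \<and> sc s' vT = t \<and>
    sc s' vOk = of_bool b \<and> clk s' \<le> clk s + k" for V t b k s'
  show ?thesis
    unfolding search_def
  proof (rule wp_SeqI[of _ "Q (\<lambda>_. 0) 0 True 1"], goal_cases)
    case 1
    show ?case
      using env V T by (simp add: wp_simps Q_def env_def)
  next
    case (2 s1)
    show ?case
    proof (rule wp_SeqI[of _ "Q (pattern {1..n} {}) 0 True (20 * n + 21)"], goal_cases)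
      case 1
      show ?case
        by (rule wp_mono[OF wp_fill]) (use 2 in \<open>auto simp: Q_def\<close>)
    next
      case (2 s2)
      show ?case
      proof (rule wp_SeqI[of _ "Q (pattern {1..n} {}) 0 c0 (20 * n + 80 * ?K + 81)"], goal_cases)
        case 1
        have "free_once Y (pattern {1..n} {})"
          using ir by (intro free_once_pattern) auto
        then have "wp check (\<lambda>s'. unchanged (insert vOk check_vars) {Flag} s2 s' \<and> env Y n s' \<and>
            sc s' vOk = of_bool (True \<and> safe Y (pattern {1..n} {}) (?K + 1) 0) \<and>
            clk s' \<le> clk s2 + 80 * ?K + 60) s2"
          using 2 pattern_range[of "{1..n}" "{}"]
          by (intro wp_check[OF Y, where b = False]) (auto simp: Q_def)
        then show ?case
          by (rule wp_mono) (use 2 in \<open>auto simp: Q_def unchanged_def c0_def\<close>)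
      next
        case (2 s3)
        show ?case
        proof (rule wp_SeqI[of _ "\<lambda>s'. \<exists>t. Q (pattern ?R {}) t c0 (50 * n + 80 * ?K + 101) s'"], goal_cases)
          case 1
          show ?case
            by (rule wp_mono[OF wp_release]) (use 2 in \<open>auto simp: Q_def\<close>)
        next
          case (2 s4)
          show ?case
          proof (rule wp_SeqI[of _ "Q (pattern ?R {}) 1 c0 (50 * n + 80 * ?K + 102)"], goal_cases)
            case 1
            show ?case
              using 2 by (auto simp: wp_simps Q_def env_def)
          next
            case (2 s5)
            show ?case
            proof (rule wp_SeqI[of _ "Q (pattern ?R {}) 1 c1
                (50 * n + 80 * ?K + 122 + n * (80 * ?K + 100))"], goal_cases)
              case 1
              show ?case
                by (rule wp_mono[OF wp_check_units[OF Y ir, where c = c0]])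
                  (use 2 in \<open>auto simp: Q_def c1_def\<close>)
            next
              case (2 s6)
              show ?case
                by (rule wp_mono[OF wp_check_all[OF Y ir, where c = c1]])
                  (use 2 nz in \<open>auto simp: Q_def\<close>)
            qed
          qed
        qed
      qed
    qed
  qed
qed

section \<open>Reading the input and the total running time\<close>

lemma card_reads_of: "card (reads_of Y i) = length (filter (read_instr i) Y)"
  by (simp add: reads_of_def length_filter_conv_card)

lemma card_reads: "card (reads Y) = length (filter (\<lambda>u. \<exists>i. read_instr i u) Y)"
  by (simp add: reads_def length_filter_conv_card)

lemma wp_read_input:
  fixes Y n m
  defines "X \<equiv> Y @ [Plain (OutSet True), Term]"
  assumes Y: "reads_and_jumps Y"
  shows "wp read_input (\<lambda>s. env Y n s \<and> ar s Value = (\<lambda>_. 0) \<and> sc s vT = 0 \<and> sc s vOk = 0 \<and>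
      sc s vM = int m \<and> sc s vE = int (card (reads Y)) \<and> clk s \<le> 60 * length Y + 150)
    (st_init (encode_input n m X))"
proof -
  let ?read = "\<lambda>u. \<exists>i. read_instr i u"
  define cnt where "cnt p i = length (filter (read_instr i) (take p X))" for p i
  define tot where "tot p = length (filter ?read (take p X))" for p
  define J where "J p s \<longleftrightarrow> p \<le> length X \<and> sc s vP = int p \<and>
    inp s = concat (map encode_prim (drop p X)) \<and>
    (\<forall>q<p. [ar s Form q, ar s Param q] = encode_prim (X ! q)) \<and>
    (\<forall>i. ar s Count i = int (cnt p i)) \<and> sc s vE = int (tot p) \<and>
    (0 < sc s vC \<longleftrightarrow> p < length X) \<and>
    sc s vN = int n \<and> sc s vM = int m \<and> sc s vOne = 1 \<and> sc s vTwo = 2 \<and> sc s vNeg = - 1 \<and>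
    sc s vZero = 0 \<and> sc s vOk = 0 \<and> sc s vT = 0 \<and>
    ar s Value = (\<lambda>_. 0) \<and> ar s Flag = (\<lambda>_. 0) \<and> outp s = [] \<and> clk s \<le> 60 * p + 10" for p and s :: st
  define I where "I k s \<longleftrightarrow> (\<exists>p. k = length X - p \<and> J p s)" for k s
  show ?thesis
    unfolding read_input_def
  proof (rule wp_SeqI[of _ "J 0"], goal_cases)
    case 1
    show ?case
      by (simp add: wp_simps wp_Read J_def st_init_def encode_input_def X_def cnt_def tot_def)
  next
    case (2 s1)
    show ?case
    \<comment> \<open>Subtracting the three ticks of the loop exit allows the time bound in
      \<open>J\<close> to be reused unchanged.\<close>
    proof (rule wp_SeqI[of _ "\<lambda>s. J (length X) (s\<lparr>clk := clk s - 3\<rparr>)"], goal_cases)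
      case 1
      have "I (length X) s1"
        using 2 unfolding I_def by (intro exI[of _ 0]) simp
      then show ?case
      proof (rule wp_Loop[of I], goal_cases)
        case (1 k s)
        then obtain p where p: "J p s" "k = length X - p" "p < length X"
          by (auto simp: I_def J_def)
        have dr: "concat (map encode_prim (drop p X)) =
            encode_prim (X ! p) @ concat (map encode_prim (drop (Suc p) X))"
          using p(3) by (simp add: Cons_nth_drop_Suc[symmetric])
        have Suc_p: "cnt (Suc p) i = cnt p i + of_bool (read_instr i (X ! p))"
          "tot (Suc p) = tot p + of_bool (?read (X ! p))" for i
          using p by (simp_all add: cnt_def tot_def take_Suc_conv_app_nth)
        have not_last: "Suc p < length X" if "X ! p \<noteq> Term"
        proof (rule ccontr)
          assume "\<not> Suc p < length X"
          then have "p = Suc (length Y)"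
            using p by (simp add: X_def)
          then show False
            using that by (simp add: X_def nth_append)
        qed
        consider i where "X ! p = PosTest (InGet i)" | i where "X ! p = NegTest (InGet i)"
          | l where "X ! p = Jump l" | "X ! p = Plain (OutSet True)"
          | "X ! p = Term" "\<not> Suc p < length X"
        proof (cases "p < length Y")
          case True
          with Y show ?thesis
            by (cases rule: reads_and_jumps_cases) (use True that in \<open>auto simp: X_def nth_append\<close>)
        next
          case False
          then have "p = length Y \<or> p = Suc (length Y)"
            using p by (auto simp: X_def)
          then show ?thesis
            using that by (auto simp: X_def nth_append)
        qed
        then have "wp read_body (J (Suc p)) (s\<lparr>clk := clk s + 3\<rparr>)"
          by cases (use p not_last in
            \<open>auto simp: read_body_def wp_simps wp_Read J_def dr Suc_p read_instr_def less_Suc_eq\<close>)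
        then show ?case
        proof (rule wp_mono)
          fix s' assume "J (Suc p) s'"
          then have "I (length X - Suc p) s'"
            unfolding I_def by blast
          then show "\<exists>k'<k. I k' s'"
            using p by (metis diff_less_mono2 lessI)
        qed
      next
        case (2 k s)
        then obtain p where "J p s" "\<not> p < length X"
          by (auto simp: I_def J_def)
        then show ?case
          by (auto simp: J_def)
      qed
    next
      case (2 s2)
      have "filter (read_instr i) X = filter (read_instr i) Y" "filter ?read X = filter ?read Y" for i
        by (auto simp: X_def read_instr_def)
      then show ?case
        using 2 by (auto simp: wp_simps J_def env_def card_reads_of card_reads cnt_def tot_def X_def nth_append)
    qed
  qed
qed

text \<open>The reads of different registers are disjoint; each register contributes one at least,
  and a member of \<open>multi Y n\<close> two.\<close>

lemma card_multi_le:
  assumes "iregs Y = {1..n}"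
  shows "n + card (multi Y n) \<le> card (reads Y)"
proof -
  have R1: "1 \<le> card (reads_of Y i)" if "i \<in> {1..n}" for i
  proof -
    have "i \<in> iregs Y"
      using that assms by simp
    then obtain p where "p \<in> reads_of Y i"
      unfolding iregs_def reads_of_def by (auto simp: in_set_conv_nth)
    then show ?thesis
      by (auto simp: Suc_le_eq card_gt_0_iff)
  qed
  have "card (multi Y n) = (\<Sum>i\<in>{1..n}. if 2 \<le> card (reads_of Y i) then 1 else 0)"
    unfolding multi_def card_eq_sum by (rule sum.inter_filter) simp
  then have "n + card (multi Y n) = (\<Sum>i\<in>{1..n}. 1 + (if 2 \<le> card (reads_of Y i) then 1 else 0))"
    unfolding sum.distrib by simp
  also have "\<dots> \<le> (\<Sum>i\<in>{1..n}. card (reads_of Y i))"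
    using R1 by (intro sum_mono) auto
  also have "\<dots> = card (\<Union>i\<in>{1..n}. reads_of Y i)"
    by (rule card_UN_disjoint[symmetric]) (auto dest: reads_of_unique)
  also have "\<dots> \<le> card (reads Y)"
    by (rule card_mono) (auto simp: reads_of_def reads_def)
  finally show ?thesis .
qed

lemma wp_decide_tstnz:
  assumes Y: "reads_and_jumps Y" and ir: "iregs Y = {1..n}" and len: "length Y + 2 = L n + m"
    and "1 \<le> n" "1 \<le> m"
  shows "wp decide_tstnz (\<lambda>s. outp s = [if nonzero_test Y n then 1 else 0] \<and>
      clk s \<le> 2000 * (2 ^ (6 * m) * (n + m) + n * (n + m)))
    (st_init (encode_input n m (Y @ [Plain (OutSet True), Term])))"
proof -
  let ?K = "length Y"
  define W where "W = 2 ^ (6 * m) * (n + m) + n * (n + m)"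
  have L: "2 * L n \<le> 3 * n + 3"
    by (auto simp: L_def)
  \<comment> \<open>Here \<open>4 * (L n + m - 2) + 4 - 5 * n\<close> is at most
    \<open>n + 4 * m + 2\<close>, and \<open>m \<ge> 1\<close> gives
    \<open>2 \<le> 2 * m\<close>.\<close>
  have bound: "card (reads Y) \<le> n + 6 * m" if "nonzero_test Y n"
    using card_reads_le[OF that] len L \<open>1 \<le> m\<close> by linarith
  have K: "?K \<le> 3 * (n + m)"
    using len L by presburger
  have lin: "n + m \<le> W"
  proof -
    have "1 * (n + m) \<le> 2 ^ (6 * m) * (n + m)"
      by (rule mult_right_mono) auto
    then show ?thesis
      unfolding mult_1 W_def by (rule trans_le_add1)
  qed
  have quad: "n * (80 * ?K + 100) + 2 ^ (6 * m) * (80 * ?K + 40 * n + 100) \<le> 400 * W"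
  proof -
    have "n * (80 * ?K + 100) \<le> n * (400 * (n + m))"
      using K \<open>1 \<le> n\<close> by (intro mult_left_mono) auto
    moreover have "2 ^ (6 * m) * (80 * ?K + 40 * n + 100) \<le> 2 ^ (6 * m) * (400 * (n + m))"
      using K \<open>1 \<le> n\<close> by (intro mult_left_mono) auto
    ultimately show ?thesis
      by (simp add: W_def algebra_simps)
  qed
  define Q where "Q s \<longleftrightarrow> env Y n s \<and> ar s Value = (\<lambda>_. 0) \<and> sc s vT = 0 \<and> sc s vOk = 0 \<and>
    sc s vU = int (card (reads Y)) - int n - int (6 * m) \<and> clk s \<le> 60 * ?K + 160" for s
  show ?thesis
    unfolding decide_tstnz_def W_def[symmetric]
  proof (rule wp_SeqI[OF wp_read_input[OF Y]], rule wp_SeqI[of _ Q], goal_cases)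
    case (1 s1)
    then show ?case
      by (auto simp: wp_simps Q_def env_def)
  next
    case (2 s1 s2)
    then have clk: "clk s2 \<le> 60 * ?K + 160"
      by (simp add: Q_def)
    show ?case
    proof (rule wp_SeqI[of _ "\<lambda>s. outp s = [] \<and> sc s vOk = of_bool (nonzero_test Y n) \<and>
        clk s \<le> 1900 * W"], goal_cases)
      case 1
      let ?s = "s2\<lparr>clk := clk s2 + 3\<rparr>"
      show ?case
      proof (cases "card (reads Y) \<le> n + 6 * m")
        case False
        then have "\<not> nonzero_test Y n"
          using bound by auto
        moreover have "0 < sc s2 vU"
          using 2 False by (simp add: Q_def)
        moreover have "clk s2 + 3 \<le> 1900 * W"
          using clk K lin \<open>1 \<le> n\<close> by simp
        ultimately show ?thesis
          using 2 by (simp add: wp_simps Q_def env_def)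
      next
        case True
        then have "card (multi Y n) \<le> 6 * m"
          using card_multi_le[OF ir] by linarith
        \<comment> \<open>Having passed the count test, the sequence has few enough repeatedly read
          registers for the enumeration to fit the bound.\<close>
        then have pow: "2 ^ card (multi Y n) * (80 * ?K + 40 * n + 100)
            \<le> 2 ^ (6 * m) * (80 * ?K + 40 * n + 100)"
          by (intro mult_right_mono power_increasing) auto
        have "n * (80 * ?K + 100) + 2 ^ card (multi Y n) * (80 * ?K + 40 * n + 100) \<le> 400 * W"
          using add_left_mono[OF pow] quad by (rule order_trans)
        moreover have "clk ?s + (50 * n + 80 * ?K + 200) \<le> 1500 * W"
          using clk K lin \<open>1 \<le> n\<close> by simp
        ultimately have time: "clk ?s + (50 * n + 80 * ?K + 200) + n * (80 * ?K + 100) +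
            2 ^ card (multi Y n) * (80 * ?K + 40 * n + 100) \<le> 1900 * W"
          by linarith
        have "wp search (\<lambda>s. outp s = [] \<and> sc s vOk = of_bool (nonzero_test Y n) \<and> clk s \<le> 1900 * W) ?s"
          by (rule wp_mono[OF wp_search[OF Y]]) (use 2 ir time in \<open>auto simp: Q_def env_def\<close>)
        moreover have "\<not> 0 < sc s2 vU"
          using 2 True by (simp add: Q_def)
        ultimately show ?thesis
          by (simp add: wp_simps)
      qed
    next
      case (2 s3)
      then show ?case
        using lin \<open>1 \<le> n\<close> by (auto simp: wp_simps)
    qed
  qed
qed

theorem theorem8:
  shows "\<exists>(P :: ram_prog) (T :: nat \<Rightarrow> nat \<Rightarrow> nat).
    (\<lambda>(n, m). real (T n m))
      \<in> O[principal {(n, m). n \<ge> 1 \<and> m \<ge> 1}](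
          \<lambda>(n, m). real (2 ^ (6 * m) * (n + m) + n * (n + m)))
    \<and> (\<forall>(n :: nat) (m :: nat) (X :: prim_instr list).
        n \<ge> 1 \<longrightarrow> m \<ge> 1 \<longrightarrow> X \<in> IS \<longrightarrow> good X \<longrightarrow>
        length X = L n + m \<longrightarrow> iregs X = {1..n} \<longrightarrow>
        ram_decides_within P (encode_input n m X) (computes X n (tstnz n)) (T n m))"
proof (intro exI conjI allI impI)
  let ?T = "\<lambda>n m. 2000 * (2 ^ (6 * m) * (n + m) + n * (n + m))"
  show "(\<lambda>(n, m). real (?T n m)) \<in> O[principal {(n, m). n \<ge> 1 \<and> m \<ge> 1}](
      \<lambda>(n, m). real (2 ^ (6 * m) * (n + m) + n * (n + m)))"
    by (rule bigoI[of _ 2000]) (auto simp: eventually_principal)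
  fix n m X
  assume "1 \<le> n" "1 \<le> m" "good X" "length X = L n + m" "iregs X = {1..n}"
  then obtain Y where X: "X = Y @ [Plain (OutSet True), Term]" and Y: "reads_and_jumps Y"
    unfolding good_def reads_and_jumps_def by blast
  have "iregs Y = {1..n}"
    using \<open>iregs X = {1..n}\<close> by (auto simp: iregs_def X read_instr_def)
  then show "ram_decides_within (compile 0 decide_tstnz) (encode_input n m X)
      (computes X n (tstnz n)) (?T n m)"
    unfolding X computes_tstnz_iff[OF Y]
    using \<open>1 \<le> n\<close> \<open>1 \<le> m\<close> \<open>length X = L n + m\<close>
    by (intro ram_decides_within_compile wp_decide_tstnz Y) (auto simp: X)
qed

end
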